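(* Consider the Poisson $i\mathcal{S}$-graph with legitimate-node density $\lambda_\ell>0$, eavesdropper density $\lambda_{\mathrm e}>0$, secrecy rate threshold zero, equal noise powers, and random propagation effects $Z_{x_i,x_j}$ distributed according to the density $f_Z(z)$. Then the average node degrees of a typical node are $$\mathbb{E}\{N_{\mathrm{in}}\}=\mathbb{E}\{N_{\mathrm{out}}\}=\frac{\lambda_\ell}{\lambda_{\mathrm e}},$$ for any distribution $f_Z(z)$.
   Context: $\Pi_\ell$ (legitimate nodes) and $\Pi_{\mathrm e}$ (eavesdroppers) are mutually independent homogeneous Poisson point processes on $\mathbb{R}^2$ with densities $\lambda_\ell>0$, $\lambda_{\mathrm e}>0$. To each pair of distinct points $u,v$ (legitimate node–legitimate node or legitimate node–eavesdropper) is attached a positive random variable $Z_{u,v}=Z_{v,u}$; these variables are i.i.d. over unordered pairs with probability density function $f_Z$, and independent of $\Pi_\ell,\Pi_{\mathrm e}$. The power gain of the link $\overrightarrow{uv}$ is $g(|u-v|,Z_{u,v})$, where $g(r,z)>0$ is continuous and strictly decreasing in $r$, with $\lim_{r\to\infty}g(r,z)=0$. $i\mathcal{S}$-graph with zero threshold and equal noise powers: the directed graph on the legitimate nodes with edge $\overrightarrow{xy}$ if and only if the maximum secrecy rate of the link is positive, which in this setting is equivalent to $$g(|x-y|,Z_{x,y})>g(|x-e^*|,Z_{x,e^*}),\qquad e^*=\operatorname*{argmax}_{e\in\Pi_{\mathrm e}} g(|x-e|,Z_{x,e}).$$ As implicit in this definition, the maximizer $e^*$ is assumed to exist almost surely.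 Typical node: the node at the origin when the graph is built on the legitimate-node set $\Pi_\ell\cup\{0\}$ with eavesdroppers $\Pi_{\mathrm e}$. $N_{\mathrm{out}}$ (resp. $N_{\mathrm{in}}$) is the number of $x\in\Pi_\ell$ with an edge $\overrightarrow{0x}$ (resp. $\overrightarrow{x0}$). *)

theory Defs
  imports "HOL-Probability.Probability"
begin

text \<open>Homogeneous Poisson point processes on the plane, as random locally finite point sets.
  The Poisson probabilities are written out, since \<^const>\<open>poisson_pmf\<close> is only meaningful for a
  strictly positive rate and the area of \<open>B\<close> may be zero.\<close>

type_synonym point = "real^2"

definition poisson_point_process :: "'w measure \<Rightarrow> real \<Rightarrow> ('w \<Rightarrow> point set) \<Rightarrow> bool" where
  "poisson_point_process M lam Phi \<longleftrightarrow>
     (\<forall>\<omega>\<in>space M. \<forall>B. bounded B \<longrightarrow> finite (Phi \<omega> \<inter> B)) \<and>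
     (\<forall>B. B \<in> sets borel \<and> bounded B \<longrightarrow>
        (\<lambda>\<omega>. card (Phi \<omega> \<inter> B)) \<in> measurable M (count_space UNIV) \<and>
        (\<forall>k. measure M {\<omega>\<in>space M. card (Phi \<omega> \<inter> B) = k} =
               (lam * measure lborel B) ^ k / fact k * exp (- (lam * measure lborel B)))) \<and>
     (\<forall>(I :: nat set) B. finite I \<and> disjoint_family_on B I \<and>
        (\<forall>i\<in>I. B i \<in> sets borel \<and> bounded (B i)) \<longrightarrow>
        prob_space.indep_vars M (\<lambda>_. count_space UNIV) (\<lambda>i \<omega>. card (Phi \<omega> \<inter> B i)) I)"

definition process_events :: "'w measure \<Rightarrow> ('w \<Rightarrow> point set) \<Rightarrow> 'w set set" where
  "process_events M Phi =
     sigma_sets (space M)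
       {{\<omega>\<in>space M. card (Phi \<omega> \<inter> B) = k} | B k. B \<in> sets borel \<and> bounded B}"

definition indep_processes ::
  "'w measure \<Rightarrow> ('w \<Rightarrow> point set) \<Rightarrow> ('w \<Rightarrow> point set) \<Rightarrow> bool" where
  "indep_processes M Phi Psi \<longleftrightarrow>
     prob_space.indep_set M (process_events M Phi) (process_events M Psi)"

text \<open>Link marks. A family of i.i.d. variables indexed by all pairs of points of the plane cannot
  be evaluated measurably at the random points of the processes. As usual for marked point
  processes, the points are therefore labelled by measurable enumerations, and the marks of the
  labelled pairs are i.i.d. and independent of the labelled positions. The node at the origin gets
  a label of its own; pairs of two eavesdroppers carry no mark. A mark configuration is a function
  on unordered pairs \<open>{u, v}\<close>, which builds in \<open>Z u v = Z v u\<close>.\<close>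

datatype label = Origin | Legit nat | Eaves nat

primrec position ::
  "(nat \<Rightarrow> 'w \<Rightarrow> point) \<Rightarrow> (nat \<Rightarrow> 'w \<Rightarrow> point) \<Rightarrow> 'w \<Rightarrow> label \<Rightarrow> point" where
  "position X Y \<omega> Origin = 0"
| "position X Y \<omega> (Legit i) = X i \<omega>"
| "position X Y \<omega> (Eaves j) = Y j \<omega>"

definition links :: "label set set" where
  "links = {{p, q} | p q. p \<noteq> q \<and> \<not> (p \<in> range Eaves \<and> q \<in> range Eaves)}"

definition enumerates :: "'w measure \<Rightarrow> (nat \<Rightarrow> 'w \<Rightarrow> point) \<Rightarrow> ('w \<Rightarrow> point set) \<Rightarrow> bool" where
  "enumerates M X Phi \<longleftrightarrow>
     (\<forall>i. X i \<in> borel_measurable M) \<and>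
     (AE \<omega> in M. inj (\<lambda>i. X i \<omega>) \<and> range (\<lambda>i. X i \<omega>) = Phi \<omega>)"

definition link_mark ::
  "(nat \<Rightarrow> 'w \<Rightarrow> point) \<Rightarrow> (nat \<Rightarrow> 'w \<Rightarrow> point) \<Rightarrow> ('w \<Rightarrow> point set \<Rightarrow> real) \<Rightarrow> label set \<Rightarrow> 'w \<Rightarrow> real"
  where "link_mark X Y Z s \<omega> = Z \<omega> (position X Y \<omega> ` s)"

definition iid_link_marks ::
  "'w measure \<Rightarrow> ('w \<Rightarrow> point set) \<Rightarrow> ('w \<Rightarrow> point set) \<Rightarrow> ('w \<Rightarrow> point set \<Rightarrow> real)
    \<Rightarrow> (real \<Rightarrow> real) \<Rightarrow> bool" where
  "iid_link_marks M Pl Pe Z f \<longleftrightarrow>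
     (\<exists>X Y. enumerates M X Pl \<and> enumerates M Y Pe \<and>
        prob_space.indep_vars M (\<lambda>_. borel) (link_mark X Y Z) links \<and>
        (\<forall>s\<in>links. distributed M lborel (link_mark X Y Z s) (\<lambda>z. ennreal (f z)) \<and>
                   (AE \<omega> in M. link_mark X Y Z s \<omega> > 0)) \<and>
        prob_space.indep_set M
          (sets (vimage_algebra (space M) (position X Y) (Pi\<^sub>M UNIV (\<lambda>_. borel))))
          (sets (vimage_algebra (space M) (\<lambda>\<omega>. \<lambda>s\<in>links. link_mark X Y Z s \<omega>)
                   (Pi\<^sub>M links (\<lambda>_. borel)))))"

text \<open>Only distances \<open>r > 0\<close> and marks \<open>z > 0\<close> matter, so that singular path loss such as
  \<open>z / r ^ 4\<close> is covered.\<close>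

definition power_gain_function :: "(real \<Rightarrow> real \<Rightarrow> real) \<Rightarrow> bool" where
  "power_gain_function g \<longleftrightarrow>
     (\<forall>r>0. \<forall>z>0. g r z > 0) \<and>
     (\<forall>z>0. continuous_on {0<..} (\<lambda>r. g r z)) \<and>
     (\<forall>z>0. strict_antimono_on {0<..} (\<lambda>r. g r z)) \<and>
     (\<forall>z>0. ((\<lambda>r. g r z) \<longlongrightarrow> 0) at_top) \<and>
     (\<forall>r>0. g r \<in> borel_measurable (restrict_space borel {0<..}))"

text \<open>In the following, \<open>\<zeta>\<close> is one realization of the marks and \<open>E\<close> one of the eavesdroppers.\<close>

definition gain ::
  "(real \<Rightarrow> real \<Rightarrow> real) \<Rightarrow> (point set \<Rightarrow> real) \<Rightarrow> point \<Rightarrow> point \<Rightarrow> real" where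
  "gain g \<zeta> x y = g (dist x y) (\<zeta> {x, y})"

definition has_strongest_eavesdropper ::
  "(real \<Rightarrow> real \<Rightarrow> real) \<Rightarrow> (point set \<Rightarrow> real) \<Rightarrow> point set \<Rightarrow> point \<Rightarrow> bool" where
  "has_strongest_eavesdropper g \<zeta> E x \<longleftrightarrow> (\<exists>e. is_arg_max (gain g \<zeta> x) (\<lambda>e. e \<in> E) e)"

definition strongest_eavesdropper ::
  "(real \<Rightarrow> real \<Rightarrow> real) \<Rightarrow> (point set \<Rightarrow> real) \<Rightarrow> point set \<Rightarrow> point \<Rightarrow> point" where
  "strongest_eavesdropper g \<zeta> E x = arg_max_on (gain g \<zeta> x) E"

text \<open>Maximum secrecy rate of a link of gain \<open>a\<close> against an eavesdropper of gain \<open>b\<close>: the secrecy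
  capacity of the Gaussian wiretap channel with transmit power \<open>P\<close> and noise powers \<open>nl\<close>
  (legitimate receiver) and \<open>ne\<close> (eavesdropper).\<close>

definition secrecy_rate :: "real \<Rightarrow> real \<Rightarrow> real \<Rightarrow> real \<Rightarrow> real \<Rightarrow> real" where
  "secrecy_rate P nl ne a b = max 0 (log 2 (1 + P * a / nl) - log 2 (1 + P * b / ne))"

definition iS_graph ::
  "real \<Rightarrow> real \<Rightarrow> real \<Rightarrow> real \<Rightarrow> (real \<Rightarrow> real \<Rightarrow> real) \<Rightarrow> (point set \<Rightarrow> real)
    \<Rightarrow> point set \<Rightarrow> point set \<Rightarrow> (point \<times> point) set" where
  "iS_graph \<rho> P nl ne g \<zeta> V E =
     {(x, y). x \<in> V \<and> y \<in> V \<and> x \<noteq> y \<and>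
        secrecy_rate P nl ne (gain g \<zeta> x y) (gain g \<zeta> x (strongest_eavesdropper g \<zeta> E x)) > \<rho>}"

text \<open>Degrees take values in \<^typ>\<open>ennreal\<close>, so an infinite degree counts as infinity.\<close>

definition out_degree :: "(point \<times> point) set \<Rightarrow> point \<Rightarrow> ennreal" where
  "out_degree G x = emeasure (count_space UNIV) {y. (x, y) \<in> G}"

definition in_degree :: "(point \<times> point) set \<Rightarrow> point \<Rightarrow> ennreal" where
  "in_degree G x = emeasure (count_space UNIV) {y. (y, x) \<in> G}"

lemma secrecy_rate_pos_iff:
  assumes "P > 0" "n > 0" "a \<ge> 0" "b \<ge> 0"
  shows "secrecy_rate P n n a b > 0 \<longleftrightarrow> a > b"
proof -
  have "0 \<le> P * a / n" "0 \<le> P * b / n"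
    using assms by auto
  then have "log 2 (1 + P * b / n) < log 2 (1 + P * a / n) \<longleftrightarrow> P * b / n < P * a / n"
    by (subst log_less_cancel_iff) auto
  also have "\<dots> \<longleftrightarrow> b < a"
    using assms by (simp add: divide_less_cancel)
  finally show ?thesis
    by (auto simp: secrecy_rate_def)
qed

lemma iS_graph_zero_threshold_iff:
  assumes "P > 0" "n > 0"
    and "gain g \<zeta> x y \<ge> 0" "gain g \<zeta> x (strongest_eavesdropper g \<zeta> E x) \<ge> 0"
  shows "(x, y) \<in> iS_graph 0 P n n g \<zeta> V E \<longleftrightarrow>
           x \<in> V \<and> y \<in> V \<and> x \<noteq> y \<and>
           gain g \<zeta> x y > gain g \<zeta> x (strongest_eavesdropper g \<zeta> E x)"
  using assms by (simp add: iS_graph_def secrecy_rate_pos_iff)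

end

theory Submission
  imports Defs
begin

text \<open>
  Given the positions, the marks are i.i.d., so the probability of an edge factorizes over the
  eavesdroppers. Campbell's formula for the legitimate nodes and the generating functional of the
  eavesdroppers turn both mean degrees into \<open>lam_l * \<integral> exp (- L (g |x| w)) dx f(w) dw\<close>, where
  \<open>L t\<close> is \<open>lam_e\<close> times the measure of the pairs \<open>(y, v)\<close> with \<open>g |y| v \<ge> t\<close>; for the in-degree
  this uses translation invariance.
  Now \<open>exp (- L t) = Pr (R < t)\<close>, where \<open>R\<close> is the largest eavesdropper gain seen from the origin,
  and exchanging the integrals gives \<open>lam_l / lam_e * E (L R)\<close>. The distribution function of \<open>R\<close> is
  continuous because \<open>g\<close> is strictly decreasing in the distance, hence \<open>L R\<close> is a standard
  exponential variable and \<open>E (L R) = 1\<close>.\<close>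

subsection \<open>The exponential on the extended nonnegative reals\<close>

text \<open>For general \<open>g\<close> and \<open>f\<close> there is no closed form of
  \<open>L\<close>, so the degree integral cannot be evaluated directly. The exchange works because
  a legitimate node and an eavesdropper at the same distance have gains with the same law: the
  measure of the pairs \<open>(x, w)\<close> whose gain exceeds \<open>R\<close> is
  \<open>L R\<close> up to the factor \<open>lam_e\<close>, and all that remains of \<open>f\<close>
  and \<open>g\<close> is the law of \<open>L R\<close>. Edges at different nodes share
  eavesdroppers and are dependent, but a mean degree is a sum of edge probabilities, so this
  dependence never enters. The existence of a strongest eavesdropper makes \<open>R\<close> finite,
  so that \<open>nexp \<circ> L\<close> really increases to 1; otherwise \<open>L\<close> could be
  constantly infinite and every edge probability would vanish. Two technical points shape the text.
  Products over infinitely many eavesdroppers may have zero factors and \<open>L\<close> takes the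
  value \<open>\<top>\<close>, hence an exponential and a logarithm on
  \<open>[0, \<infinity>]\<close>. And a degree agrees with a measurable function only outside a
  null set, hence the completion of \<open>M\<close>.\<close>

definition nexp :: "ennreal \<Rightarrow> ennreal" where
  "nexp x = (if x = \<top> then 0 else ennreal (exp (- enn2real x)))"

text \<open>The inverse of \<open>nexp\<close> on \<open>[0, 1]\<close>. It turns a product of
  probabilities over the points of a process into \<open>nexp\<close> of a sum over these points,
  which is the shape that the generating functional handles; the value \<open>\<top>\<close> at 0
  accounts for vanishing factors.\<close>

definition nln :: "ennreal \<Rightarrow> ennreal" where
  "nln p = (if p = 0 then \<top> else ennreal (- ln (enn2real p)))"

lemma nexp_top [simp]: "nexp \<top> = 0"
  by (simp add: nexp_def)

lemma nexp_0 [simp]: "nexp 0 = 1"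
  by (simp add: nexp_def)

lemma nexp_ennreal: "0 \<le> r \<Longrightarrow> nexp (ennreal r) = ennreal (exp (- r))"
  by (simp add: nexp_def)

lemma nexp_le_1: "nexp x \<le> 1"
  by (simp add: nexp_def)

lemma nexp_antimono: "x \<le> y \<Longrightarrow> nexp y \<le> nexp x"
  by (cases x; cases y) (auto simp: nexp_ennreal top_unique)

lemma nexp_strict_antimono: "x < y \<Longrightarrow> nexp y < nexp x"
  by (cases x; cases y) (auto simp: nexp_ennreal ennreal_less_iff top_unique)

lemma nexp_eq_iff [simp]: "nexp x = nexp y \<longleftrightarrow> x = y"
  by (metis less_irrefl linorder_less_linear nexp_strict_antimono)

lemma nexp_add: "nexp (x + y) = nexp x * nexp y"
  by (cases x; cases y)
    (auto simp: nexp_ennreal ennreal_plus[symmetric] ennreal_mult'[symmetric] exp_add[symmetric]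
      simp del: ennreal_plus)

lemma nexp_sum: "nexp (\<Sum>i\<in>I. f i) = (\<Prod>i\<in>I. nexp (f i))"
  by (induction I rule: infinite_finite_induct) (simp_all add: nexp_add)

lemma nexp_nln: "p \<le> 1 \<Longrightarrow> nexp (nln p) = p"
  by (cases p) (auto simp: nexp_ennreal nln_def ennreal_eq_0_iff top_unique)

text \<open>An order-reversing bijection onto \<open>[0, 1]\<close> exchanges suprema and infima:
  \<open>nln\<close> of the infimum is an upper bound of all \<open>f i\<close>. No separate limit
  argument at infinity is needed.\<close>

lemma nexp_SUP:
  fixes f :: "nat \<Rightarrow> ennreal"
  shows "nexp (SUP i. f i) = (INF i. nexp (f i))"
proof (rule antisym)
  show "nexp (SUP i. f i) \<le> (INF i. nexp (f i))"
    by (intro INF_greatest nexp_antimono SUP_upper) auto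
  show "(INF i. nexp (f i)) \<le> nexp (SUP i. f i)"
  proof (rule ccontr)
    assume "\<not> ?thesis"
    then have less: "nexp (SUP i. f i) < (INF i. nexp (f i))" (is "?a < ?b") by simp
    have "?b \<le> 1"
      by (rule INF_lower2[of 0]) (auto simp: nexp_le_1)
    then have b: "nexp (nln ?b) = ?b"
      by (rule nexp_nln)
    have "f i \<le> nln ?b" for i
    proof (rule ccontr)
      assume "\<not> f i \<le> nln ?b"
      then have "nexp (f i) < nexp (nln ?b)"
        by (intro nexp_strict_antimono) simp
      moreover have "?b \<le> nexp (f i)"
        by (rule INF_lower) simp
      ultimately show False
        unfolding b by simp
    qed
    then have "(SUP i. f i) \<le> nln ?b"
      by (intro SUP_least) auto
    then show False
      using nexp_antimono[of "SUP i. f i" "nln ?b"] less unfolding b by simp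
  qed
qed

lemma measurable_nexp [measurable]: "nexp \<in> borel_measurable borel"
  unfolding nexp_def by measurable

lemma measurable_nln [measurable]: "nln \<in> borel_measurable borel"
  unfolding nln_def by measurable

text \<open>Both forms are kept because the tail of \<open>L R\<close> is bounded above only for the
  strict event and below only for the weak one; the integral cannot tell the two forms
  apart.\<close>

lemma layer_cake:
  fixes x :: ennreal
  shows "(\<integral>\<^sup>+s\<in>{0<..}. indicator {s. ennreal s < x} s \<partial>lborel) = x"
    and "(\<integral>\<^sup>+s\<in>{0<..}. indicator {s. ennreal s \<le> x} s \<partial>lborel) = x"
proof -
  have le: "(\<integral>\<^sup>+s\<in>{0<..}. indicator {s. ennreal s \<le> x} s \<partial>lborel) \<le> x"
  proof (cases x)
    case (real r)
    have "(\<integral>\<^sup>+s\<in>{0<..}. indicator {s. ennreal s \<le> x} s \<partial>lborel) \<le> (\<integral>\<^sup>+s. indicator {0..r} s \<partial>lborel)"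
      using real by (intro nn_integral_mono) (auto split: split_indicator)
    then show ?thesis using real by simp
  qed simp
  have ge: "x \<le> (\<integral>\<^sup>+s\<in>{0<..}. indicator {s. ennreal s < x} s \<partial>lborel)"
  proof (cases x)
    case (real r)
    have "x = (\<integral>\<^sup>+s. indicator {0<..<r} s \<partial>lborel)"
      using real by simp
    also have "\<dots> \<le> (\<integral>\<^sup>+s\<in>{0<..}. indicator {s. ennreal s < x} s \<partial>lborel)"
      using real by (intro nn_integral_mono) (auto split: split_indicator simp: ennreal_less_iff)
    finally show ?thesis .
  next
    case top
    have "(\<integral>\<^sup>+s\<in>{0<..}. indicator {s. ennreal s < x} s \<partial>lborel) = (\<integral>\<^sup>+s. indicator {0::real<..} s \<partial>lborel)"
      unfolding top by (intro nn_integral_cong) (simp split: split_indicator add: ennreal_less_top)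
    also have "\<dots> = \<top>"
    proof -
      have "ennreal (real k) \<le> emeasure lborel {0::real<..}" for k
      proof -
        have "ennreal (real k) = emeasure lborel {0<..<real k}" by simp
        also have "\<dots> \<le> emeasure lborel {0::real<..}" by (intro emeasure_mono) auto
        finally show ?thesis .
      qed
      then have "(SUP k. ennreal (real k)) \<le> emeasure lborel {0::real<..}"
        by (intro SUP_least)
      then show ?thesis
        by (simp add: ennreal_of_nat_eq_real_of_nat[symmetric] ennreal_SUP_of_nat_eq_top top_unique)
    qed
    finally show ?thesis by simp
  qed
  have mono: "(\<integral>\<^sup>+s\<in>{0<..}. indicator {s. ennreal s < x} s \<partial>lborel)
      \<le> (\<integral>\<^sup>+s\<in>{0<..}. indicator {s. ennreal s \<le> x} s \<partial>lborel)"
    by (intro nn_integral_mono) (auto split: split_indicator)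
  show "(\<integral>\<^sup>+s\<in>{0<..}. indicator {s. ennreal s < x} s \<partial>lborel) = x"
    and "(\<integral>\<^sup>+s\<in>{0<..}. indicator {s. ennreal s \<le> x} s \<partial>lborel) = x"
    using le ge mono by (auto intro: antisym order_trans)
qed

text \<open>\<open>L\<close> is the cumulative hazard of \<open>R\<close> in reversed time. Since the distribution function
  \<open>nexp \<circ> L\<close> is continuous, \<open>L\<close> takes every positive value, which makes \<open>L R\<close> a standard
  exponential variable.\<close>

lemma (in prob_space) nn_integral_hazard_eq_1:
  fixes R :: "'a \<Rightarrow> real" and L :: "real \<Rightarrow> ennreal"
  assumes R [measurable]: "R \<in> borel_measurable M"
    and L [measurable]: "L \<in> borel_measurable borel" and "antimono L"
    and less: "\<And>t. emeasure M {\<omega>\<in>space M. R \<omega> < t} = nexp (L t)"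
    and le: "\<And>t. emeasure M {\<omega>\<in>space M. R \<omega> \<le> t} = nexp (L t)"
  shows "(\<integral>\<^sup>+\<omega>. L (R \<omega>) \<partial>M) = 1"
proof -
  define D where "D = distr M borel R"
  interpret D: real_distribution D
    unfolding D_def by simp
  have cdf: "ennreal (cdf D t) = nexp (L t)" for t
    by (simp add: cdf_def D_def D.emeasure_eq_measure[symmetric, unfolded D_def] emeasure_distr
        le[symmetric] vimage_def Int_def conj_commute)
  \<comment> \<open>\<open>less\<close> and \<open>le\<close> have the same right-hand side, so the
    law of \<open>R\<close> has no atoms.\<close>
  have "isCont (cdf D) t" for t
  proof -
    have "emeasure D {..t} = emeasure D {..<t}"
      using less[of t] le[of t] by (simp add: D_def emeasure_distr vimage_def Int_def conj_commute)
    moreover have "{..t} - {..<t} = {t}" by auto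
    then have "emeasure D {t} = emeasure D {..t} - emeasure D {..<t}"
      using emeasure_Diff[of D "{..<t}" "{..t}"] D.emeasure_finite[of "{..<t}"]
      by (auto simp: D_def less_imp_le subset_iff)
    ultimately have "emeasure D {t} = 0" by simp
    then show ?thesis
      by (simp add: D.isCont_cdf measure_def)
  qed
  \<comment> \<open>For \<open>s > 0\<close> the value \<open>exp (- s)\<close> lies strictly
    between the limits 0 and 1 of the distribution function, so the intermediate value theorem
    applies. At \<open>s = 0\<close> the value 1 need not be attained.\<close>
  have level: "\<exists>t. L t = ennreal s" if "0 < s" for s
  proof -
    have "eventually (\<lambda>t. cdf D t < exp (- s)) at_bot"
      using D.cdf_lim_at_bot by (rule order_tendstoD) simp
    then obtain a where a: "\<And>t. t \<le> a \<Longrightarrow> cdf D t < exp (- s)"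
      by (auto simp: eventually_at_bot_linorder)
    have "eventually (\<lambda>t. exp (- s) < cdf D t) at_top"
      using D.cdf_lim_at_top_prob by (rule order_tendstoD) (use that in simp)
    then obtain b where b: "\<And>t. t \<ge> b \<Longrightarrow> exp (- s) < cdf D t"
      by (auto simp: eventually_at_top_linorder)
    obtain t where "cdf D t = exp (- s)"
      using IVT[of "cdf D" "min a b" "exp (- s)" "max a b"] a[of "min a b"] b[of "max a b"]
        \<open>\<And>t. isCont (cdf D) t\<close> by force
    then have "nexp (L t) = nexp (ennreal s)"
      using that cdf[of t] by (simp add: nexp_ennreal)
    then show ?thesis by auto
  qed
  have upper: "emeasure M {\<omega>\<in>space M. ennreal s < L (R \<omega>)} \<le> ennreal (exp (- s))"
    and lower: "ennreal (exp (- s)) \<le> emeasure M {\<omega>\<in>space M. ennreal s \<le> L (R \<omega>)}"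
    if "0 < s" for s
  proof -
    \<comment> \<open>\<open>L\<close> may be flat around \<open>t\<close>, so events are only
      compared: \<open>L R > s\<close> implies \<open>R < t\<close>, which implies
      \<open>L R \<ge> s\<close>.\<close>
    obtain t where t: "L t = ennreal s"
      using level \<open>0 < s\<close> by blast
    have "emeasure M {\<omega>\<in>space M. R \<omega> < t} = ennreal (exp (- s))"
      using that by (simp add: less t nexp_ennreal)
    moreover have "emeasure M {\<omega>\<in>space M. ennreal s < L (R \<omega>)} \<le> emeasure M {\<omega>\<in>space M. R \<omega> < t}"
    proof (rule emeasure_mono, safe)
      fix \<omega> assume "ennreal s < L (R \<omega>)"
      then show "R \<omega> < t"
        using antimonoD[OF \<open>antimono L\<close>, of t "R \<omega>"] t by (auto simp: not_less[symmetric])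
    qed measurable
    moreover have "emeasure M {\<omega>\<in>space M. R \<omega> < t} \<le> emeasure M {\<omega>\<in>space M. ennreal s \<le> L (R \<omega>)}"
    proof (rule emeasure_mono, safe)
      fix \<omega> assume "R \<omega> < t"
      then show "ennreal s \<le> L (R \<omega>)"
        using antimonoD[OF \<open>antimono L\<close>, of "R \<omega>" t] t by simp
    qed measurable
    ultimately show "emeasure M {\<omega>\<in>space M. ennreal s < L (R \<omega>)} \<le> ennreal (exp (- s))"
      and "ennreal (exp (- s)) \<le> emeasure M {\<omega>\<in>space M. ennreal s \<le> L (R \<omega>)}"
      by simp_all
  qed
  interpret P: pair_sigma_finite M "lborel :: real measure"
    by unfold_locales
  have total: "(\<integral>\<^sup>+s. ennreal (exp (- s)) * indicator {0<..} s \<partial>lborel) = 1"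
  proof -
    have "(\<integral>\<^sup>+s. ennreal (exp (- s)) * indicator {0<..} s \<partial>lborel)
        = (\<integral>\<^sup>+s. ennreal (s ^ 0 * exp (- s)) * indicator {0..} s \<partial>lborel)"
      using AE_lborel_singleton[of "0::real"]
      by (intro nn_integral_cong_AE) (auto split: split_indicator)
    then show ?thesis
      using nn_intergal_power_times_exp_Ici[of 0] by simp
  qed
  have swap: "(\<integral>\<^sup>+\<omega>. (\<integral>\<^sup>+s\<in>{0<..}. indicator {s. Q s \<omega>} s \<partial>lborel) \<partial>M)
      = (\<integral>\<^sup>+s. emeasure M {\<omega>\<in>space M. Q s \<omega>} * indicator {0<..} s \<partial>lborel)"
    if [measurable]: "Measurable.pred (M \<Otimes>\<^sub>M borel) (\<lambda>(\<omega>, s). Q s \<omega>)" for Q :: "real \<Rightarrow> 'a \<Rightarrow> bool"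
  proof -
    have "(\<integral>\<^sup>+\<omega>. (\<integral>\<^sup>+s\<in>{0<..}. indicator {s. Q s \<omega>} s \<partial>lborel) \<partial>M)
        = (\<integral>\<^sup>+\<omega>. (\<integral>\<^sup>+s. indicator {x. case x of (\<omega>, s) \<Rightarrow> Q s \<omega>} (\<omega>, s) * indicator {0<..} s \<partial>lborel) \<partial>M)"
      by (intro nn_integral_cong) (auto split: split_indicator)
    also have "\<dots> = (\<integral>\<^sup>+s. (\<integral>\<^sup>+\<omega>. indicator {x. case x of (\<omega>, s) \<Rightarrow> Q s \<omega>} (\<omega>, s) * indicator {0<..} s \<partial>M) \<partial>lborel)"
      by (rule P.Fubini'[symmetric]) measurable
    also have "\<dots> = (\<integral>\<^sup>+s. emeasure M {\<omega>\<in>space M. Q s \<omega>} * indicator {0<..} s \<partial>lborel)"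
    proof (intro nn_integral_cong)
      fix s :: real
      have "(\<integral>\<^sup>+\<omega>. indicator {x. case x of (\<omega>, s) \<Rightarrow> Q s \<omega>} (\<omega>, s) * indicator {0<..} s \<partial>M)
         = (\<integral>\<^sup>+\<omega>. indicator {0<..} s * indicator {\<omega>\<in>space M. Q s \<omega>} \<omega> \<partial>M)"
        by (intro nn_integral_cong) (auto split: split_indicator)
      also have "\<dots> = indicator {0<..} s * emeasure M {\<omega>\<in>space M. Q s \<omega>}"
        by (subst nn_integral_cmult_indicator) measurable
      finally show "(\<integral>\<^sup>+\<omega>. indicator {x. case x of (\<omega>, s) \<Rightarrow> Q s \<omega>} (\<omega>, s) * indicator {0<..} s \<partial>M)
         = emeasure M {\<omega>\<in>space M. Q s \<omega>} * indicator {0<..} s"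
        by (simp add: mult.commute)
    qed
    finally show ?thesis .
  qed
  have "(\<integral>\<^sup>+\<omega>. L (R \<omega>) \<partial>M)
      = (\<integral>\<^sup>+s. emeasure M {\<omega>\<in>space M. ennreal s < L (R \<omega>)} * indicator {0<..} s \<partial>lborel)"
    by (subst swap[symmetric]) (simp_all add: layer_cake)
  also have "\<dots> \<le> (\<integral>\<^sup>+s. ennreal (exp (- s)) * indicator {0<..} s \<partial>lborel)"
    using upper by (intro nn_integral_mono) (auto split: split_indicator)
  finally have "(\<integral>\<^sup>+\<omega>. L (R \<omega>) \<partial>M) \<le> 1"
    unfolding total .
  moreover have "(\<integral>\<^sup>+s. ennreal (exp (- s)) * indicator {0<..} s \<partial>lborel)
      \<le> (\<integral>\<^sup>+s. emeasure M {\<omega>\<in>space M. ennreal s \<le> L (R \<omega>)} * indicator {0<..} s \<partial>lborel)"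
    using lower by (intro nn_integral_mono) (auto split: split_indicator)
  moreover have "\<dots> = (\<integral>\<^sup>+\<omega>. L (R \<omega>) \<partial>M)"
    by (subst swap[symmetric]) (simp_all add: layer_cake)
  ultimately show ?thesis
    unfolding total by (intro antisym) simp_all
qed

subsection \<open>Poisson counts and the generating functional\<close>

lemma nn_integral_nat_valued:
  fixes h :: "nat \<Rightarrow> ennreal"
  assumes [measurable]: "N \<in> measurable M (count_space UNIV)"
  shows "(\<integral>\<^sup>+\<omega>. h (N \<omega>) \<partial>M) = (\<Sum>k. h k * emeasure M {\<omega>\<in>space M. N \<omega> = k})"
proof -
  have "h (N \<omega>) = (\<Sum>k. h k * indicator {\<omega>\<in>space M. N \<omega> = k} \<omega>)" if "\<omega> \<in> space M" for \<omega>
    using that by (subst suminf_finite[of "{N \<omega>}"]) auto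
  then have "(\<integral>\<^sup>+\<omega>. h (N \<omega>) \<partial>M) = (\<integral>\<^sup>+\<omega>. (\<Sum>k. h k * indicator {\<omega>\<in>space M. N \<omega> = k} \<omega>) \<partial>M)"
    by (intro nn_integral_cong)
  also have "\<dots> = (\<Sum>k. \<integral>\<^sup>+\<omega>. h k * indicator {\<omega>\<in>space M. N \<omega> = k} \<omega> \<partial>M)"
    by (rule nn_integral_suminf) measurable
  also have "\<dots> = (\<Sum>k. h k * emeasure M {\<omega>\<in>space M. N \<omega> = k})"
    by (subst nn_integral_cmult_indicator) auto
  finally show ?thesis .
qed

lemma emeasure_lborel_bounded_eq:
  fixes B :: "'a::euclidean_space set"
  assumes "bounded B" "B \<in> sets borel"
  shows "emeasure lborel B = ennreal (measure lborel B)"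
proof -
  have "emeasure lborel B < \<infinity>"
    using emeasure_bounded_finite[OF assms(1)] .
  then show ?thesis
    by (simp add: emeasure_eq_ennreal_measure)
qed

text \<open>\<open>process_events\<close> as a measurable space. Independence of the two processes
  is available only for events of this kind, so functionals of the eavesdroppers have to be
  measurable here and not merely with respect to \<open>M\<close>.\<close>

definition process_algebra :: "'w measure \<Rightarrow> ('w \<Rightarrow> point set) \<Rightarrow> 'w measure" where
  "process_algebra M Phi = sigma (space M)
     {{\<omega>\<in>space M. card (Phi \<omega> \<inter> B) = k} | B k. B \<in> sets borel \<and> bounded B}"

lemma space_process_algebra [simp]: "space (process_algebra M Phi) = space M"
  by (simp add: process_algebra_def space_measure_of_conv)

lemma sets_process_algebra: "sets (process_algebra M Phi) = process_events M Phi"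
  unfolding process_algebra_def process_events_def by (rule sets_measure_of) auto

locale planar_ppp = prob_space M for M :: "'w measure" +
  fixes lam :: real and Phi :: "'w \<Rightarrow> point set"
  assumes ppp: "poisson_point_process M lam Phi" and lam_pos: "lam > 0"
begin

abbreviation F where "F \<equiv> process_algebra M Phi"

lemma finite_points: "\<omega> \<in> space M \<Longrightarrow> bounded B \<Longrightarrow> finite (Phi \<omega> \<inter> B)"
  using ppp by (auto simp: poisson_point_process_def)

lemma measurable_card [measurable]:
  "B \<in> sets borel \<Longrightarrow> bounded B \<Longrightarrow> (\<lambda>\<omega>. card (Phi \<omega> \<inter> B)) \<in> measurable M (count_space UNIV)"
  using ppp by (auto simp: poisson_point_process_def)

lemma measurable_card_F [measurable]:
  assumes "B \<in> sets borel" "bounded B"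
  shows "(\<lambda>\<omega>. card (Phi \<omega> \<inter> B)) \<in> measurable F (count_space UNIV)"
proof (rule measurable_count_space_eq2_countable[THEN iffD2], safe)
  fix k
  have "{\<omega>\<in>space M. card (Phi \<omega> \<inter> B) = k} \<in> process_events M Phi"
    unfolding process_events_def using assms by (intro sigma_sets.Basic) blast
  moreover have "(\<lambda>\<omega>. card (Phi \<omega> \<inter> B)) -` {k} \<inter> space F = {\<omega>\<in>space M. card (Phi \<omega> \<inter> B) = k}"
    by auto
  ultimately show "(\<lambda>\<omega>. card (Phi \<omega> \<inter> B)) -` {k} \<inter> space F \<in> sets F"
    by (simp add: sets_process_algebra)
qed auto

lemma subalgebra_F: "subalgebra M F"
proof -
  have "process_events M Phi \<subseteq> sets M"
    unfolding process_events_def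
  proof (rule sets.sigma_sets_subset, safe)
    fix B :: "point set" and k assume B [measurable]: "B \<in> sets borel" "bounded B"
    show "{\<omega>\<in>space M. card (Phi \<omega> \<inter> B) = k} \<in> sets M"
      by measurable
  qed
  then show ?thesis
    by (simp add: subalgebra_def sets_process_algebra)
qed

lemma emeasure_card_eq:
  assumes "B \<in> sets borel" "bounded B"
  shows "emeasure M {\<omega>\<in>space M. card (Phi \<omega> \<inter> B) = k}
      = ennreal ((lam * measure lborel B) ^ k / fact k * exp (- (lam * measure lborel B)))"
  using ppp assms unfolding poisson_point_process_def emeasure_eq_measure by simp

text \<open>The Laplace transform of a Poisson variable: the Poisson weights times
  \<open>exp (- (a * k))\<close> form an exponential series in \<open>m * exp (- a)\<close>, where
  \<open>m\<close> is the mean.\<close>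

lemma nn_integral_exp_card:
  assumes B: "B \<in> sets borel" "bounded B" and "0 \<le> a"
  shows "(\<integral>\<^sup>+\<omega>. ennreal (exp (- (a * real (card (Phi \<omega> \<inter> B))))) \<partial>M)
      = ennreal (exp (- (lam * measure lborel B * (1 - exp (- a)))))"
proof -
  let ?m = "lam * measure lborel B"
  have m: "0 \<le> ?m" using lam_pos by simp
  have "(\<integral>\<^sup>+\<omega>. ennreal (exp (- (a * real (card (Phi \<omega> \<inter> B))))) \<partial>M)
      = (\<Sum>k. ennreal (exp (- (a * real k))) * ennreal (?m ^ k / fact k * exp (- ?m)))"
    by (subst nn_integral_nat_valued) (use B in \<open>simp_all add: emeasure_card_eq\<close>)
  also have "\<dots> = (\<Sum>k. ennreal (exp (- ?m) * ((?m * exp (- a)) ^ k /\<^sub>R fact k)))"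
    using m by (intro suminf_cong) (simp add: ennreal_mult'[symmetric] power_mult_distrib
        exp_of_nat_mult[symmetric] field_simps)
  also have "\<dots> = ennreal (exp (- ?m) * exp (?m * exp (- a)))"
    using m by (intro suminf_ennreal_eq sums_mult exp_converges) auto
  also have "exp (- ?m) * exp (?m * exp (- a)) = exp (- (?m * (1 - exp (- a))))"
    by (simp add: exp_add[symmetric] algebra_simps)
  finally show ?thesis .
qed

text \<open>The Poisson mean on an event that is independent of the count. Restricting the measure
  to \<open>A\<close> reduces it to a sum over the values of the count, in which the probability of
  \<open>A\<close> factors out.\<close>

lemma nn_integral_card:
  assumes B: "B \<in> sets borel" "bounded B" and A: "A \<in> sets M"
    and indep: "\<And>k. prob ({\<omega>\<in>space M. card (Phi \<omega> \<inter> B) = k} \<inter> A) = prob {\<omega>\<in>space M. card (Phi \<omega> \<inter> B) = k} * prob A"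
  shows "(\<integral>\<^sup>+\<omega>. of_nat (card (Phi \<omega> \<inter> B)) * indicator A \<omega> \<partial>M) = ennreal lam * emeasure lborel B * emeasure M A"
proof -
  let ?m = "lam * measure lborel B"
  have m: "0 \<le> ?m" using lam_pos by simp
  have [measurable]: "A \<in> sets M" by fact
  have "(\<integral>\<^sup>+\<omega>. of_nat (card (Phi \<omega> \<inter> B)) * indicator A \<omega> \<partial>M)
      = (\<integral>\<^sup>+\<omega>. of_nat (card (Phi \<omega> \<inter> B)) \<partial>restrict_space M A)"
    by (subst nn_integral_restrict_space) (use A sets.sets_into_space in auto)
  also have "\<dots> = (\<Sum>k. of_nat k * emeasure (restrict_space M A) {\<omega>\<in>space (restrict_space M A). card (Phi \<omega> \<inter> B) = k})"
    by (rule nn_integral_nat_valued, rule measurable_restrict_space1) (use B in measurable)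
  also have "\<dots> = (\<Sum>k. of_nat k * (emeasure M {\<omega>\<in>space M. card (Phi \<omega> \<inter> B) = k} * emeasure M A))"
  proof (rule suminf_cong)
    fix k
    have eq: "{\<omega>\<in>space (restrict_space M A). card (Phi \<omega> \<inter> B) = k} = {\<omega>\<in>space M. card (Phi \<omega> \<inter> B) = k} \<inter> A"
      using sets.sets_into_space[OF A] by (auto simp: space_restrict_space)
    have "emeasure (restrict_space M A) ({\<omega>\<in>space M. card (Phi \<omega> \<inter> B) = k} \<inter> A)
        = emeasure M ({\<omega>\<in>space M. card (Phi \<omega> \<inter> B) = k} \<inter> A)"
      using A by (intro emeasure_restrict_space) auto
    also have "\<dots> = emeasure M {\<omega>\<in>space M. card (Phi \<omega> \<inter> B) = k} * emeasure M A"
      unfolding emeasure_eq_measure indep by (simp add: ennreal_mult)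
    finally show "of_nat k * emeasure (restrict_space M A) {\<omega>\<in>space (restrict_space M A). card (Phi \<omega> \<inter> B) = k}
      = of_nat k * (emeasure M {\<omega>\<in>space M. card (Phi \<omega> \<inter> B) = k} * emeasure M A)"
      unfolding eq by simp
  qed
  also have "\<dots> = (\<Sum>k. of_nat k * emeasure M {\<omega>\<in>space M. card (Phi \<omega> \<inter> B) = k}) * emeasure M A"
    by (simp add: mult.assoc[symmetric])
  also have "(\<Sum>k. of_nat k * emeasure M {\<omega>\<in>space M. card (Phi \<omega> \<inter> B) = k})
      = (\<Sum>k. ennreal (real k * (?m ^ k / fact k * exp (- ?m))))"
    using B m by (intro suminf_cong)
      (simp add: emeasure_card_eq ennreal_mult'[symmetric] ennreal_of_nat_eq_real_of_nat)
  also have "\<dots> = ennreal ?m"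
  proof -
    \<comment> \<open>The term for \<open>k = 0\<close> vanishes; after a shift by one the factor
      \<open>k\<close> cancels against the factorial and leaves \<open>m\<close> times an
      exponential series.\<close>
    have "(\<lambda>k. ?m * exp (- ?m) * (?m ^ k /\<^sub>R fact k)) sums (?m * exp (- ?m) * exp ?m)"
      by (intro sums_mult exp_converges)
    then have "(\<lambda>k. real (Suc k) * (?m ^ Suc k / fact (Suc k) * exp (- ?m))) sums ?m"
      by (simp add: field_simps exp_add[symmetric] del: of_nat_Suc)
    then have "(\<lambda>k. real k * (?m ^ k / fact k * exp (- ?m))) sums ?m"
      by (subst (asm) sums_Suc_iff) simp
    then show ?thesis
      using m by (intro suminf_ennreal_eq) auto
  qed
  also have "ennreal ?m = ennreal lam * emeasure lborel B"
    using B lam_pos by (simp add: emeasure_lborel_bounded_eq ennreal_mult)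
  finally show ?thesis .
qed

end

lemma nn_integral_indicator_count_space:
  "(\<integral>\<^sup>+y. indicator S y \<partial>count_space A) = emeasure (count_space UNIV) (A \<inter> S)"
proof -
  have "(\<integral>\<^sup>+y. indicator S y \<partial>count_space A) = (\<integral>\<^sup>+y. indicator S y * indicator A y \<partial>count_space UNIV)"
    by (rule nn_integral_count_space_indicator) simp
  also have "\<dots> = (\<integral>\<^sup>+y. indicator (A \<inter> S) y \<partial>count_space UNIV)"
    by (intro nn_integral_cong) (auto split: split_indicator)
  finally show ?thesis by simp
qed

section \<open>Measurability of sums over the points, and the generating functional\<close>

context planar_ppp
begin

text \<open>On a rectangle the count is an indicator times a plain count, and Dynkin's argument
  extends this to all \<open>S\<close>. Complements lead to differences of counts, which must be
  finite; this is the purpose of the ball.\<close>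

lemma measurable_points_slice:
  assumes S: "S \<in> sets (T \<Otimes>\<^sub>M (borel :: point measure))"
  shows "(\<lambda>x. emeasure (count_space UNIV) (Phi (snd x) \<inter> ball 0 (real n) \<inter> Pair (fst x) -` S))
      \<in> borel_measurable (T \<Otimes>\<^sub>M F)"
proof -
  let ?c = "\<lambda>S x. emeasure (count_space UNIV) (Phi (snd x) \<inter> ball 0 (real n) \<inter> Pair (fst x) -` S)"
  have rectangle: "?c (A \<times> B) \<in> borel_measurable (T \<Otimes>\<^sub>M F)" if A [measurable]: "A \<in> sets T" and B: "B \<in> sets borel" for A B
  proof -
    have "?c (A \<times> B) x = indicator A (fst x) * of_nat (card (Phi (snd x) \<inter> (ball 0 (real n) \<inter> B)))"
      if "x \<in> space (T \<Otimes>\<^sub>M F)" for x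
    proof -
      have "finite (Phi (snd x) \<inter> (ball 0 (real n) \<inter> B))"
        using that by (intro finite_points bounded_Int) (auto simp: space_pair_measure)
      then show ?thesis
        by (cases "fst x \<in> A") (simp_all add: Int_assoc vimage_def Int_def)
    qed
    moreover have [measurable]: "(\<lambda>\<omega>. card (Phi \<omega> \<inter> (ball 0 (real n) \<inter> B))) \<in> measurable F (count_space UNIV)"
      using B by (intro measurable_card_F bounded_Int) auto
    have "(\<lambda>x. indicator A (fst x) * of_nat (card (Phi (snd x) \<inter> (ball 0 (real n) \<inter> B))) :: ennreal)
        \<in> borel_measurable (T \<Otimes>\<^sub>M F)"
      by measurable
    ultimately show ?thesis
      by (subst measurable_cong) auto
  qed
  have "S \<in> sigma_sets (space T \<times> space borel) {a \<times> b | a b. a \<in> sets T \<and> b \<in> sets (borel :: point measure)}"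
    using S by (simp add: sets_pair_measure)
  with Int_stable_pair_measure_generator pair_measure_closed show ?thesis
  proof (induction rule: sigma_sets_induct_disjoint)
    case (basic S)
    then show ?case
      using rectangle by auto
  next
    case empty
    then show ?case by simp
  next
    case (compl S)
    have "?c (space T \<times> space borel - S) x = ?c (space T \<times> space borel) x - ?c S x"
      if "x \<in> space (T \<Otimes>\<^sub>M F)" for x
    proof -
      let ?P = "Phi (snd x) \<inter> ball 0 (real n)"
      have "finite ?P"
        using that by (intro finite_points) (auto simp: space_pair_measure)
      then have "finite (?P \<inter> Pair (fst x) -` S)"
        by simp
      then have "emeasure (count_space UNIV) (?P \<inter> Pair (fst x) -` S) \<noteq> \<infinity>"
        by simp
      moreover have "?P \<inter> Pair (fst x) -` S \<subseteq> ?P \<inter> Pair (fst x) -` (space T \<times> space borel)"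
        using that by (auto simp: space_pair_measure)
      moreover have "?P \<inter> Pair (fst x) -` (space T \<times> space borel - S)
          = ?P \<inter> Pair (fst x) -` (space T \<times> space borel) - ?P \<inter> Pair (fst x) -` S"
        by auto
      ultimately show ?thesis
        using emeasure_Diff[of "count_space UNIV" "?P \<inter> Pair (fst x) -` S"
            "?P \<inter> Pair (fst x) -` (space T \<times> space borel)"] by simp
    qed
    moreover have "(\<lambda>x. ?c (space T \<times> space borel) x - ?c S x) \<in> borel_measurable (T \<Otimes>\<^sub>M F)"
      using rectangle[of "space T" "space borel"] compl by measurable
    ultimately show ?case
      by (subst measurable_cong) auto
  next
    case (union S)
    have "?c (\<Union>(range S)) x = (\<Sum>i. ?c (S i) x)" for x
    proof (subst suminf_emeasure)
      show "disjoint_family (\<lambda>i. Phi (snd x) \<inter> ball 0 (real n) \<inter> Pair (fst x) -` S i)"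
        using union(1) by (auto simp: disjoint_family_on_def)
    qed (auto intro!: arg_cong[where f = "emeasure (count_space UNIV)"])
    then show ?case
      by (simp only:) (intro borel_measurable_suminf_order union.IH)
  qed
qed

text \<open>The parameter in \<open>T\<close> is needed for Campbell's formula, where the sum over
  the eavesdroppers depends on the position of a legitimate node and on its mark.\<close>

lemma measurable_points_integral:
  fixes k :: "'t \<times> point \<Rightarrow> ennreal"
  assumes "k \<in> borel_measurable (T \<Otimes>\<^sub>M borel)"
  shows "(\<lambda>x. \<integral>\<^sup>+y. k (fst x, y) \<partial>count_space (Phi (snd x))) \<in> borel_measurable (T \<Otimes>\<^sub>M F)"
  using assms
proof (induction rule: borel_measurable_induct)
  case (cong f g)
  have "(\<integral>\<^sup>+y. f (fst x, y) \<partial>count_space (Phi (snd x))) = (\<integral>\<^sup>+y. g (fst x, y) \<partial>count_space (Phi (snd x)))"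
    if "x \<in> space (T \<Otimes>\<^sub>M F)" for x
    using that cong(3) by (intro nn_integral_cong) (auto simp: space_pair_measure)
  then show ?case
    using cong(4) by (subst measurable_cong) auto
next
  \<comment> \<open>The balls exhaust the plane, so the cut-off disappears in a monotone
    limit.\<close>
  case (set S)
  have "(\<integral>\<^sup>+y. indicator S (fst x, y) \<partial>count_space (Phi (snd x)))
      = (SUP n. emeasure (count_space UNIV) (Phi (snd x) \<inter> ball 0 (real n) \<inter> Pair (fst x) -` S))" for x
  proof -
    have "(\<integral>\<^sup>+y. indicator S (fst x, y) \<partial>count_space (Phi (snd x)))
        = (\<integral>\<^sup>+y. indicator (Pair (fst x) -` S) y \<partial>count_space (Phi (snd x)))"
      by (intro nn_integral_cong) (auto split: split_indicator)
    also have "\<dots> = emeasure (count_space UNIV) (\<Union>n. Phi (snd x) \<inter> ball 0 (real n) \<inter> Pair (fst x) -` S)"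
      by (auto simp: nn_integral_indicator_count_space reals_Archimedean2
          intro!: arg_cong[where f = "emeasure (count_space UNIV)"])
    also have "\<dots> = (SUP n. emeasure (count_space UNIV) (Phi (snd x) \<inter> ball 0 (real n) \<inter> Pair (fst x) -` S))"
      by (rule SUP_emeasure_incseq[symmetric]) (auto simp: incseq_def)
    finally show ?thesis .
  qed
  then show ?case
    using measurable_points_slice[OF set] by simp
next
  case (mult u c)
  then show ?case
    by (simp add: nn_integral_cmult)
next
  case (add u v)
  then show ?case
    by (simp add: nn_integral_add)
next
  case (seq U)
  have "(\<integral>\<^sup>+y. (SUP i. U i) (fst x, y) \<partial>count_space (Phi (snd x)))
      = (SUP i. \<integral>\<^sup>+y. U i (fst x, y) \<partial>count_space (Phi (snd x)))" for x
    unfolding SUP_apply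
    using \<open>incseq U\<close> by (intro nn_integral_monotone_convergence_SUP) (auto simp: incseq_def le_fun_def)
  then show ?case
    using seq.IH by simp
qed

lemma measurable_points_integral' [measurable]:
  assumes [measurable]: "k \<in> borel_measurable borel"
  shows "(\<lambda>\<omega>. \<integral>\<^sup>+y. k y \<partial>count_space (Phi \<omega>)) \<in> borel_measurable F"
    and "(\<lambda>\<omega>. \<integral>\<^sup>+y. k y \<partial>count_space (Phi \<omega>)) \<in> borel_measurable M"
proof -
  \<comment> \<open>An integrand without parameter is covered by taking \<open>F\<close> itself as
    parameter space and composing with the diagonal.\<close>
  have 1: "(\<lambda>x. \<integral>\<^sup>+y. k (snd (fst x, y)) \<partial>count_space (Phi (snd x))) \<in> borel_measurable (F \<Otimes>\<^sub>M F)"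
    by (rule measurable_points_integral[where k = "\<lambda>x. k (snd x)"]) measurable
  have 2: "(\<lambda>\<omega>. (\<omega>, \<omega>)) \<in> measurable F (F \<Otimes>\<^sub>M F)"
    by measurable
  show "(\<lambda>\<omega>. \<integral>\<^sup>+y. k y \<partial>count_space (Phi \<omega>)) \<in> borel_measurable F"
    using measurable_compose[OF 2 1] by simp
  then show "(\<lambda>\<omega>. \<integral>\<^sup>+y. k y \<partial>count_space (Phi \<omega>)) \<in> borel_measurable M"
    by (rule measurable_from_subalg[OF subalgebra_F])
qed

text \<open>The counts in disjoint pieces are independent, so the expectation is a product of
  Laplace transforms of Poisson variables. Their exponents add up to the integral of
  \<open>1 - nexp (k y)\<close>, again a step function on the same pieces.\<close>

lemma generating_functional_step:
  fixes B :: "nat \<Rightarrow> point set" and a :: "nat \<Rightarrow> real"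
  assumes I: "finite I" and disj: "disjoint_family_on B I"
    and B: "\<And>i. i \<in> I \<Longrightarrow> B i \<in> sets borel" "\<And>i. i \<in> I \<Longrightarrow> bounded (B i)"
    and a: "\<And>i. i \<in> I \<Longrightarrow> 0 \<le> a i"
    and k: "\<And>y. k y = (\<Sum>i\<in>I. ennreal (a i) * indicator (B i) y)"
  shows "(\<integral>\<^sup>+\<omega>. nexp (\<integral>\<^sup>+y. k y \<partial>count_space (Phi \<omega>)) \<partial>M)
      = nexp (ennreal lam * (\<integral>\<^sup>+y. 1 - nexp (k y) \<partial>lborel))"
proof -
  let ?e = "\<lambda>i \<omega>. ennreal (exp (- (a i * real (card (Phi \<omega> \<inter> B i)))))"
  have "nexp (\<integral>\<^sup>+y. k y \<partial>count_space (Phi \<omega>)) = (\<Prod>i\<in>I. ?e i \<omega>)" if "\<omega> \<in> space M" for \<omega>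
  proof -
    have "(\<integral>\<^sup>+y. k y \<partial>count_space (Phi \<omega>)) = (\<Sum>i\<in>I. ennreal (a i) * emeasure (count_space UNIV) (Phi \<omega> \<inter> B i))"
      unfolding k by (simp add: nn_integral_sum nn_integral_cmult nn_integral_indicator_count_space)
    also have "\<dots> = (\<Sum>i\<in>I. ennreal (a i * real (card (Phi \<omega> \<inter> B i))))"
      using that B a
      by (intro sum.cong) (simp_all add: finite_points ennreal_mult ennreal_of_nat_eq_real_of_nat)
    finally have "nexp (\<integral>\<^sup>+y. k y \<partial>count_space (Phi \<omega>))
        = (\<Prod>i\<in>I. nexp (ennreal (a i * real (card (Phi \<omega> \<inter> B i)))))"
      by (simp only: nexp_sum)
    then show ?thesis
      using a by (simp add: nexp_ennreal)
  qed
  then have "(\<integral>\<^sup>+\<omega>. nexp (\<integral>\<^sup>+y. k y \<partial>count_space (Phi \<omega>)) \<partial>M) = (\<integral>\<^sup>+\<omega>. (\<Prod>i\<in>I. ?e i \<omega>) \<partial>M)"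
    by (intro nn_integral_cong)
  also have "\<dots> = (\<Prod>i\<in>I. \<integral>\<^sup>+\<omega>. ?e i \<omega> \<partial>M)"
  proof (intro indep_vars_nn_integral I)
    have "indep_vars (\<lambda>_. count_space UNIV) (\<lambda>i \<omega>. card (Phi \<omega> \<inter> B i)) I"
    proof -
      have "finite I \<and> disjoint_family_on B I \<and> (\<forall>i\<in>I. B i \<in> sets borel \<and> bounded (B i))"
        using I disj B by simp
      then show ?thesis
        by (rule ppp[unfolded poisson_point_process_def, THEN conjunct2, THEN conjunct2, rule_format])
    qed
    from indep_vars_compose2[OF this, of "\<lambda>i n. ennreal (exp (- (a i * real n)))" "\<lambda>_. borel"]
    show "indep_vars (\<lambda>_. borel) ?e I" by simp
  qed simp
  also have "\<dots> = (\<Prod>i\<in>I. nexp (ennreal (lam * measure lborel (B i) * (1 - exp (- a i)))))"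
    using B a lam_pos by (intro prod.cong) (simp_all add: nn_integral_exp_card nexp_ennreal)
  also have "\<dots> = nexp (\<Sum>i\<in>I. ennreal (lam * measure lborel (B i) * (1 - exp (- a i))))"
    by (simp add: nexp_sum)
  also have "(\<Sum>i\<in>I. ennreal (lam * measure lborel (B i) * (1 - exp (- a i))))
      = ennreal lam * (\<integral>\<^sup>+y. (\<Sum>i\<in>I. ennreal (1 - exp (- a i)) * indicator (B i) y) \<partial>lborel)"
  proof -
    have eq: "(\<integral>\<^sup>+y. (\<Sum>i\<in>I. ennreal (1 - exp (- a i)) * indicator (B i) y) \<partial>lborel)
        = (\<Sum>i\<in>I. ennreal (1 - exp (- a i)) * emeasure lborel (B i))"
      using B by (simp add: nn_integral_sum nn_integral_cmult_indicator)
    show ?thesis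
      unfolding eq sum_distrib_left using B a lam_pos
      by (intro sum.cong)
        (simp_all add: emeasure_lborel_bounded_eq ennreal_mult'[symmetric] mult_ac)
  qed
  also have "(\<integral>\<^sup>+y. (\<Sum>i\<in>I. ennreal (1 - exp (- a i)) * indicator (B i) y) \<partial>lborel)
      = (\<integral>\<^sup>+y. 1 - nexp (k y) \<partial>lborel)"
  proof (rule nn_integral_cong)
    \<comment> \<open>By disjointness at most one piece contains \<open>y\<close>, so both sums have
      at most one nonzero term.\<close>
    fix y
    show "(\<Sum>i\<in>I. ennreal (1 - exp (- a i)) * indicator (B i) y) = 1 - nexp (k y)"
    proof (cases "\<exists>j\<in>I. y \<in> B j")
      case True
      then obtain j where j: "j \<in> I" "y \<in> B j" by blast
      then have other: "y \<notin> B i" if "i \<in> I" "i \<noteq> j" for i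
        using disj that by (auto simp: disjoint_family_on_def)
      have "(\<Sum>i\<in>I. c i * indicator (B i) y) = c j" for c :: "nat \<Rightarrow> ennreal"
        using I j other by (subst sum.remove[of _ j]) (auto intro!: sum.neutral)
      then show ?thesis
        unfolding k using a[OF j(1)]
        by (simp add: nexp_ennreal ennreal_minus[symmetric])
    next
      case False
      then have "(\<Sum>i\<in>I. c i * indicator (B i) y) = 0" for c :: "nat \<Rightarrow> ennreal"
        by (auto intro!: sum.neutral)
      then show ?thesis
        unfolding k by simp
    qed
  qed
  finally show ?thesis .
qed

text \<open>Step functions increase to \<open>k\<close>, and both sides converge monotonically; on
  the left the sequence decreases and is bounded by 1. The value \<open>\<top>\<close> has to be
  allowed for \<open>k\<close>, since \<open>k\<close> will be \<open>nln\<close> of a probability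
  that may be 0.\<close>

lemma generating_functional:
  fixes k :: "point \<Rightarrow> ennreal"
  assumes k [measurable]: "k \<in> borel_measurable borel"
  shows "(\<integral>\<^sup>+\<omega>. nexp (\<integral>\<^sup>+y. k y \<partial>count_space (Phi \<omega>)) \<partial>M)
      = nexp (ennreal lam * (\<integral>\<^sup>+y. 1 - nexp (k y) \<partial>lborel))"
proof -
  obtain f where f: "\<And>i. simple_function borel (f i)" "incseq f" "\<And>i x. f i x < \<top>"
      "\<And>x. (SUP i. f i x) = k x"
    using borel_measurable_implies_simple_function_sequence'[OF k] by blast
  have [measurable]: "f i \<in> borel_measurable borel" for i
    using f(1) by (rule borel_measurable_simple_function)
  \<comment> \<open>The simple functions are cut off by growing balls because the Poisson law and
    the independence of counts concern bounded sets.\<close>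
  define u where "u i y = f i y * indicator (ball 0 (real i)) y" for i and y :: point
  have [measurable]: "u i \<in> borel_measurable borel" for i
  proof -
    have [measurable]: "ball (0 :: point) (real i) \<in> sets borel" by simp
    show ?thesis unfolding u_def by measurable
  qed
  have "incseq u"
    using f(2) by (auto simp: incseq_def le_fun_def u_def split: split_indicator)
  then have mono: "u i y \<le> u j y" if "i \<le> j" for i j y
    using that by (auto simp: incseq_def le_fun_def)
  have sup: "(SUP i. u i y) = k y" for y
  proof (rule antisym)
    show "(SUP i. u i y) \<le> k y"
      unfolding f(4)[symmetric]
      by (intro SUP_mono) (auto simp: u_def split: split_indicator)
    obtain m where m: "norm y < real m"
      using reals_Archimedean2 by blast
    have "f i y \<le> u (max i m) y" for i
    proof -
      have "f i y \<le> f (max i m) y"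
        using f(2) by (auto simp: incseq_def le_fun_def)
      then show ?thesis
        using m by (auto simp: u_def)
    qed
    then show "k y \<le> (SUP i. u i y)"
      unfolding f(4)[symmetric] by (intro SUP_mono) auto
  qed
  have step: "(\<integral>\<^sup>+\<omega>. nexp (\<integral>\<^sup>+y. u i y \<partial>count_space (Phi \<omega>)) \<partial>M)
      = nexp (ennreal lam * (\<integral>\<^sup>+y. 1 - nexp (u i y) \<partial>lborel))" for i
  proof -
    \<comment> \<open>The level sets of \<open>f i\<close> are numbered, since independence of
      counts is available for families indexed by natural numbers.\<close>
    have fin: "finite (range (f i))"
      using simple_functionD(1)[OF f(1), of i] by simp
    then obtain h where h: "bij_betw h {0..<card (range (f i))} (range (f i))"
      using ex_bij_betw_nat_finite by blast
    let ?B = "\<lambda>j. f i -` {h j} \<inter> ball 0 (real i)"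
    show ?thesis
    proof (rule generating_functional_step[where I = "{0..<card (range (f i))}" and B = ?B
          and a = "\<lambda>j. enn2real (h j)"])
      show "disjoint_family_on ?B {0..<card (range (f i))}"
        using bij_betw_imp_inj_on[OF h] by (fastforce simp: disjoint_family_on_def inj_on_def)
      show "?B j \<in> sets borel" for j
        using measurable_sets[of "f i" borel borel "{h j}"] by auto
      show "bounded (?B j)" for j
        by (rule bounded_Int) simp
      show "u i y = (\<Sum>j\<in>{0..<card (range (f i))}. ennreal (enn2real (h j)) * indicator (?B j) y)" for y
      proof -
        obtain j where j: "j < card (range (f i))" "h j = f i y"
        proof -
          have "f i y \<in> h ` {0..<card (range (f i))}"
            unfolding bij_betw_imp_surj_on[OF h] by simp
          then show thesis
            using that by auto
        qed
        have other: "h j' \<noteq> f i y" if "j' < card (range (f i))" "j' \<noteq> j" for j'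
          using bij_betw_imp_inj_on[OF h] j that by (auto simp: inj_on_def)
        have "(\<Sum>j\<in>{0..<card (range (f i))}. ennreal (enn2real (h j)) * indicator (?B j) y)
            = (\<Sum>j'\<in>{0..<card (range (f i))}.
                if j' = j then ennreal (enn2real (h j)) * indicator (?B j) y else 0)"
          by (intro sum.cong) (use other[THEN not_sym] in \<open>auto split: split_indicator\<close>)
        also have "\<dots> = ennreal (enn2real (h j)) * indicator (?B j) y"
          using j by simp
        finally have "(\<Sum>j\<in>{0..<card (range (f i))}. ennreal (enn2real (h j)) * indicator (?B j) y)
            = ennreal (enn2real (h j)) * indicator (?B j) y" .
        then show ?thesis
          using j f(3)[of i y] by (simp add: u_def indicator_def)
      qed
    qed simp_all
  qed
  have conv: "(\<integral>\<^sup>+y. k y \<partial>count_space (Phi \<omega>)) = (SUP i. \<integral>\<^sup>+y. u i y \<partial>count_space (Phi \<omega>))" for \<omega>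
    unfolding sup[symmetric] using \<open>incseq u\<close> by (intro nn_integral_monotone_convergence_SUP) auto
  have "(\<integral>\<^sup>+\<omega>. nexp (\<integral>\<^sup>+y. k y \<partial>count_space (Phi \<omega>)) \<partial>M)
      = (\<integral>\<^sup>+\<omega>. (INF i. nexp (\<integral>\<^sup>+y. u i y \<partial>count_space (Phi \<omega>))) \<partial>M)"
    unfolding conv nexp_SUP ..
  also have "\<dots> = (INF i. \<integral>\<^sup>+\<omega>. nexp (\<integral>\<^sup>+y. u i y \<partial>count_space (Phi \<omega>)) \<partial>M)"
  proof (rule nn_integral_monotone_convergence_INF_AE')
    show "AE \<omega> in M. nexp (\<integral>\<^sup>+y. u (Suc i) y \<partial>count_space (Phi \<omega>)) \<le> nexp (\<integral>\<^sup>+y. u i y \<partial>count_space (Phi \<omega>))" for i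
      by (intro AE_I2 nexp_antimono nn_integral_mono mono) simp
    have "(\<integral>\<^sup>+\<omega>. nexp (\<integral>\<^sup>+y. u 0 y \<partial>count_space (Phi \<omega>)) \<partial>M) \<le> (\<integral>\<^sup>+\<omega>. 1 \<partial>M)"
      by (intro nn_integral_mono nexp_le_1)
    then show "(\<integral>\<^sup>+\<omega>. nexp (\<integral>\<^sup>+y. u 0 y \<partial>count_space (Phi \<omega>)) \<partial>M) < \<infinity>"
      by (auto simp: emeasure_space_1 intro: le_less_trans)
  qed measurable
  also have "\<dots> = nexp (SUP i. ennreal lam * (\<integral>\<^sup>+y. 1 - nexp (u i y) \<partial>lborel))"
    unfolding step nexp_SUP ..
  also have "(SUP i. ennreal lam * (\<integral>\<^sup>+y. 1 - nexp (u i y) \<partial>lborel))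
      = ennreal lam * (\<integral>\<^sup>+y. (SUP i. 1 - nexp (u i y)) \<partial>lborel)"
    using mono by (subst nn_integral_monotone_convergence_SUP)
      (auto simp: SUP_mult_left_ennreal incseq_def le_fun_def intro!: ennreal_minus_mono nexp_antimono)
  also have "\<dots> = ennreal lam * (\<integral>\<^sup>+y. 1 - nexp (k y) \<partial>lborel)"
    by (simp add: ennreal_INF_const_minus nexp_SUP[symmetric] sup)
  finally show ?thesis .
qed

end

subsection \<open>Campbell's formula\<close>

text \<open>The quantifier over \<open>k\<close> stands inside the almost-sure statement: one null
  set serves all integrands, including those that depend on \<omega>.\<close>

lemma enumerates_suminf:
  assumes "enumerates M X Phi"
  shows "AE \<omega> in M. \<forall>k. (\<Sum>i. k (X i \<omega>) :: ennreal) = (\<integral>\<^sup>+y. k y \<partial>count_space (Phi \<omega>))"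
proof -
  have "AE \<omega> in M. inj (\<lambda>i. X i \<omega>) \<and> range (\<lambda>i. X i \<omega>) = Phi \<omega>"
    using assms by (simp add: enumerates_def)
  then show ?thesis
  proof eventually_elim
    case (elim \<omega>)
    then have "bij_betw (\<lambda>i. X i \<omega>) UNIV (Phi \<omega>)"
      by (simp add: bij_betw_def)
    from nn_integral_bij_count_space[OF this] show ?case
      by (simp add: nn_integral_count_space_nat)
  qed
qed

lemma enumerates_measurable: "enumerates M X Phi \<Longrightarrow> X i \<in> borel_measurable M"
  by (simp add: enumerates_def)

lemma SUP_emeasure_Int_ball:
  fixes A :: "'a::real_normed_vector set"
  assumes "\<And>n. A \<inter> ball 0 (real n) \<in> sets M"
  shows "(SUP n. emeasure M (A \<inter> ball 0 (real n))) = emeasure M A"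
proof -
  have "(SUP n. emeasure M (A \<inter> ball 0 (real n))) = emeasure M (\<Union>n. A \<inter> ball 0 (real n))"
    using assms by (intro SUP_emeasure_incseq) (auto simp: incseq_def)
  also have "(\<Union>n. A \<inter> ball 0 (real n)) = A"
    by (auto simp: reals_Archimedean2)
  finally show ?thesis .
qed

context planar_ppp
begin

lemma measurable_ident_F: "(\<lambda>\<omega>. \<omega>) \<in> measurable M F"
  using subalgebra_F by (rule measurable_from_subalg) simp

lemma AE_not_in_points: "AE \<omega> in M. x \<notin> Phi \<omega>"
proof (rule AE_I')
  have B: "{x} \<in> sets borel" "bounded {x}" by simp_all
  have eq: "{\<omega>\<in>space M. \<not> x \<notin> Phi \<omega>} = {\<omega>\<in>space M. card (Phi \<omega> \<inter> {x}) = 1}"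
    by (auto simp: Int_insert_right split: if_splits)
  show "{\<omega>\<in>space M. card (Phi \<omega> \<inter> {x}) = 1} \<in> null_sets M"
    using emeasure_card_eq[OF B, of 1] measurable_card[OF B] by (auto simp: null_sets_def)
  show "{\<omega>\<in>space M. \<not> x \<notin> Phi \<omega>} \<subseteq> {\<omega>\<in>space M. card (Phi \<omega> \<inter> {x}) = 1}"
    unfolding eq ..
qed

end

section \<open>Two independent processes\<close>

locale planar_ppp_pair = L: planar_ppp M lam_l Pl + E: planar_ppp M lam_e Pe
  for M :: "'w measure" and lam_l Pl lam_e Pe +
  assumes indep_processes: "indep_processes M Pl Pe"
begin

text \<open>Campbell's formula on a rectangle. For bounded \<open>A\<close> it combines the Poisson
  mean with the independence of the processes; balls exhaust a general \<open>A\<close>.\<close>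

lemma nn_integral_points_indicator:
  assumes A [measurable]: "A \<in> sets borel" and B: "B \<in> sets E.F"
  shows "(\<integral>\<^sup>+\<omega>. emeasure (count_space UNIV) (Pl \<omega> \<inter> A) * indicator B \<omega> \<partial>M)
      = ennreal lam_l * emeasure lborel A * emeasure M B"
proof -
  have BM [measurable]: "B \<in> sets M"
    using B E.subalgebra_F by (auto simp: subalgebra_def)
  have bounded: "(\<integral>\<^sup>+\<omega>. emeasure (count_space UNIV) (Pl \<omega> \<inter> A) * indicator B \<omega> \<partial>M)
      = ennreal lam_l * emeasure lborel A * emeasure M B"
    if A: "A \<in> sets borel" "bounded A" for A
  proof -
    have "(\<integral>\<^sup>+\<omega>. emeasure (count_space UNIV) (Pl \<omega> \<inter> A) * indicator B \<omega> \<partial>M)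
        = (\<integral>\<^sup>+\<omega>. of_nat (card (Pl \<omega> \<inter> A)) * indicator B \<omega> \<partial>M)"
      using A by (intro nn_integral_cong) (simp add: L.finite_points)
    also have "\<dots> = ennreal lam_l * emeasure lborel A * emeasure M B"
    proof (rule L.nn_integral_card[OF A BM])
      fix k
      have "{\<omega>\<in>space M. card (Pl \<omega> \<inter> A) = k} \<in> process_events M Pl"
        unfolding process_events_def using A by (intro sigma_sets.Basic) blast
      then show "L.prob ({\<omega>\<in>space M. card (Pl \<omega> \<inter> A) = k} \<inter> B)
          = L.prob {\<omega>\<in>space M. card (Pl \<omega> \<inter> A) = k} * L.prob B"
        using indep_processes B unfolding indep_processes_def
        by (intro L.indep_setD) (simp_all add: sets_process_algebra)
    qed
    finally show ?thesis .
  qed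
  have meas: "(\<lambda>\<omega>. emeasure (count_space UNIV) (Pl \<omega> \<inter> A)) \<in> borel_measurable M" if "A \<in> sets borel" for A
    using L.measurable_points_integral'(2)[of "indicator A"] that
    by (simp add: nn_integral_indicator_count_space)
  let ?A = "\<lambda>n. A \<inter> ball 0 (real n)"
  have A': "?A n \<in> sets borel" "bounded (?A n)" for n
    by (auto intro: bounded_Int)
  have "(\<integral>\<^sup>+\<omega>. emeasure (count_space UNIV) (Pl \<omega> \<inter> A) * indicator B \<omega> \<partial>M)
      = (\<integral>\<^sup>+\<omega>. (SUP n. emeasure (count_space UNIV) (Pl \<omega> \<inter> ?A n) * indicator B \<omega>) \<partial>M)"
    by (simp add: SUP_mult_right_ennreal[symmetric] Int_assoc[symmetric] SUP_emeasure_Int_ball)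
  also have "\<dots> = (SUP n. \<integral>\<^sup>+\<omega>. emeasure (count_space UNIV) (Pl \<omega> \<inter> ?A n) * indicator B \<omega> \<partial>M)"
  proof (rule nn_integral_monotone_convergence_SUP)
    show "incseq (\<lambda>n \<omega>. emeasure (count_space UNIV) (Pl \<omega> \<inter> ?A n) * indicator B \<omega>)"
      by (auto simp: incseq_def le_fun_def intro!: mult_right_mono emeasure_mono)
    show "(\<lambda>\<omega>. emeasure (count_space UNIV) (Pl \<omega> \<inter> ?A n) * indicator B \<omega>) \<in> borel_measurable M" for n
      using meas[OF A'(1)] by measurable
  qed
  also have "\<dots> = (SUP n. ennreal lam_l * emeasure lborel (?A n) * emeasure M B)"
    using A' by (simp add: bounded)
  also have "\<dots> = ennreal lam_l * emeasure lborel A * emeasure M B"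
    by (simp add: SUP_mult_left_ennreal[symmetric] SUP_mult_right_ennreal[symmetric] SUP_emeasure_Int_ball)
  finally show ?thesis .
qed

text \<open>Both sides integrate \<open>H\<close> against measures on the plane times the outcomes
  that agree on rectangles, so uniqueness of the product measure settles it. \<open>H\<close> may
  depend on the outcome only through the eavesdroppers, which are independent of the legitimate
  nodes.\<close>

lemma campbell:
  fixes H :: "point \<times> 'w \<Rightarrow> ennreal"
  assumes X: "enumerates M X Pl" and H [measurable]: "H \<in> borel_measurable (borel \<Otimes>\<^sub>M E.F)"
  shows "(\<Sum>i. \<integral>\<^sup>+\<omega>. H (X i \<omega>, \<omega>) \<partial>M) = ennreal lam_l * (\<integral>\<^sup>+x. \<integral>\<^sup>+\<omega>. H (x, \<omega>) \<partial>M \<partial>lborel)"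
proof -
  \<comment> \<open>\<open>M\<close> with its events reduced to those of the eavesdroppers, the only
    ones for which the factorization on rectangles is known.\<close>
  define N where "N = restr_to_subalg M E.F"
  have sets_N [measurable_cong]: "sets N = sets E.F"
    unfolding N_def by (rule sets_restr_to_subalg[OF E.subalgebra_F])
  interpret N: prob_space N
  proof (rule prob_spaceI)
    have "space N \<in> sets E.F"
      unfolding sets_N[symmetric] by simp
    then show "emeasure N (space N) = 1"
      by (simp add: N_def emeasure_restr_to_subalg[OF E.subalgebra_F] space_restr_to_subalg L.emeasure_space_1)
  qed
  interpret P: pair_sigma_finite "count_space (UNIV :: nat set)" M
    by (intro pair_sigma_finite.intro sigma_finite_measure_count_space L.sigma_finite_measure_axioms)
  have [measurable]: "X i \<in> borel_measurable M" for i
    using X by (rule enumerates_measurable)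
  note E.measurable_ident_F [measurable]
  have XM [measurable]: "(\<lambda>p. (X (fst p) (snd p), snd p)) \<in> measurable (count_space UNIV \<Otimes>\<^sub>M M) (borel \<Otimes>\<^sub>M E.F)"
    by (rule measurable_pair_measure_countable1) auto
  \<comment> \<open>The joint intensity: the laws of the pairs (\<open>i\<close>-th legitimate node,
    outcome), summed over \<open>i\<close>.\<close>
  define Q where "Q = distr (count_space UNIV \<Otimes>\<^sub>M M) (borel \<Otimes>\<^sub>M E.F) (\<lambda>p. (X (fst p) (snd p), snd p))"
  have Q: "(\<integral>\<^sup>+p. H p \<partial>Q) = (\<Sum>i. \<integral>\<^sup>+\<omega>. H (X i \<omega>, \<omega>) \<partial>M)"
    if [measurable]: "H \<in> borel_measurable (borel \<Otimes>\<^sub>M E.F)" for H :: "point \<times> 'w \<Rightarrow> ennreal"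
  proof -
    have "(\<integral>\<^sup>+p. H p \<partial>Q) = (\<integral>\<^sup>+p. H (X (fst p) (snd p), snd p) \<partial>(count_space UNIV \<Otimes>\<^sub>M M))"
      unfolding Q_def by (subst nn_integral_distr) auto
    also have "\<dots> = (\<integral>\<^sup>+i. \<integral>\<^sup>+\<omega>. H (X i \<omega>, \<omega>) \<partial>M \<partial>count_space UNIV)"
      by (subst L.nn_integral_fst[symmetric]) auto
    finally show ?thesis
      by (simp add: nn_integral_count_space_nat)
  qed
  \<comment> \<open>The density is moved to the side of \<open>Q\<close>, so that \<open>Q\<close>
    is compared with a product of two sigma-finite measures.\<close>
  have "lborel \<Otimes>\<^sub>M N = scale_measure (1 / ennreal lam_l) Q"
  proof (rule pair_measure_eqI)
    show "sets (lborel \<Otimes>\<^sub>M N) = sets (scale_measure (1 / ennreal lam_l) Q)"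
      by (simp add: Q_def sets_N cong: sets_pair_measure_cong)
  next
    fix A B assume A: "A \<in> sets (lborel :: point measure)" and "B \<in> sets N"
    then have B: "B \<in> sets E.F" and [measurable]: "A \<in> sets borel" "B \<in> sets M"
      using E.subalgebra_F by (auto simp: sets_N subalgebra_def)
    have "emeasure Q (A \<times> B) = (\<integral>\<^sup>+p. indicator (A \<times> B) p \<partial>Q)"
      using A B by (subst nn_integral_indicator) (auto simp: Q_def)
    also have "\<dots> = (\<Sum>i. \<integral>\<^sup>+\<omega>. indicator A (X i \<omega>) * indicator B \<omega> \<partial>M)"
      using A B by (subst Q) (auto simp: indicator_times)
    also have "\<dots> = (\<integral>\<^sup>+\<omega>. (\<Sum>i. indicator A (X i \<omega>) * indicator B \<omega>) \<partial>M)"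
      by (rule nn_integral_suminf[symmetric]) measurable
    also have "\<dots> = (\<integral>\<^sup>+\<omega>. emeasure (count_space UNIV) (Pl \<omega> \<inter> A) * indicator B \<omega> \<partial>M)"
      using enumerates_suminf[OF X]
      by (intro nn_integral_cong_AE, eventually_elim) (simp add: nn_integral_indicator_count_space)
    also have "\<dots> = ennreal lam_l * emeasure lborel A * emeasure M B"
      using A B by (intro nn_integral_points_indicator) auto
    finally have "emeasure Q (A \<times> B) = ennreal lam_l * (emeasure lborel A * emeasure N B)"
      using B by (simp add: N_def emeasure_restr_to_subalg[OF E.subalgebra_F] mult.assoc)
    then show "emeasure lborel A * emeasure N B = emeasure (scale_measure (1 / ennreal lam_l) Q) (A \<times> B)"
      using L.lam_pos
      by (simp add: mult.assoc[symmetric] ennreal_divide_times ennreal_divide_self)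
  qed (unfold_locales)
  then have "ennreal lam_l * (\<integral>\<^sup>+p. H p \<partial>(lborel \<Otimes>\<^sub>M N))
      = ennreal lam_l * (1 / ennreal lam_l * (\<integral>\<^sup>+p. H p \<partial>Q))"
    by (simp only:) (subst nn_integral_scale_measure; simp add: Q_def)
  also have "\<dots> = (ennreal lam_l * (1 / ennreal lam_l)) * (\<integral>\<^sup>+p. H p \<partial>Q)"
    by (simp only: mult.assoc)
  also have "ennreal lam_l * (1 / ennreal lam_l) = 1"
    using L.lam_pos by (simp add: ennreal_times_divide ennreal_divide_self)
  finally have "(\<integral>\<^sup>+p. H p \<partial>Q) = ennreal lam_l * (\<integral>\<^sup>+p. H p \<partial>(lborel \<Otimes>\<^sub>M N))"
    by simp
  also have "(\<integral>\<^sup>+p. H p \<partial>(lborel \<Otimes>\<^sub>M N)) = (\<integral>\<^sup>+x. \<integral>\<^sup>+\<omega>. H (x, \<omega>) \<partial>N \<partial>lborel)"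
    by (rule N.nn_integral_fst[symmetric]) measurable
  also have "\<dots> = (\<integral>\<^sup>+x. \<integral>\<^sup>+\<omega>. H (x, \<omega>) \<partial>M \<partial>lborel)"
    unfolding N_def
    by (intro nn_integral_cong nn_integral_subalgebra2[OF E.subalgebra_F]) measurable
  finally show ?thesis
    by (simp add: Q)
qed

text \<open>Campbell's formula for the number of eavesdroppers located exactly at a legitimate node,
  which is almost surely 0 for each fixed position. Coincidences would evaluate \<open>g\<close> at
  distance 0, where nothing is known about it.\<close>

lemma AE_points_disjoint:
  assumes X: "enumerates M X Pl"
  shows "AE \<omega> in M. Pl \<omega> \<inter> Pe \<omega> = {}"
proof -
  let ?H = "\<lambda>p. emeasure (count_space UNIV) (Pe (snd p) \<inter> {fst p})"
  have H: "?H \<in> borel_measurable (borel \<Otimes>\<^sub>M E.F)"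
  proof -
    have "(\<lambda>p. \<integral>\<^sup>+y. indicator {x. fst x = snd x} (fst p, y) \<partial>count_space (Pe (snd p))) \<in> borel_measurable (borel \<Otimes>\<^sub>M E.F)"
      by (rule E.measurable_points_integral) measurable
    also have "(\<lambda>p. \<integral>\<^sup>+y. indicator {x. fst x = snd x} (fst p, y) \<partial>count_space (Pe (snd p)))
        = (\<lambda>p. \<integral>\<^sup>+y. indicator {fst p} y \<partial>count_space (Pe (snd p)))"
      by (intro ext nn_integral_cong) (auto split: split_indicator)
    finally show ?thesis
      by (simp add: nn_integral_indicator_count_space)
  qed
  have zero: "(\<integral>\<^sup>+\<omega>. ?H (x, \<omega>) \<partial>M) = 0" for x
  proof -
    have "(\<integral>\<^sup>+\<omega>. ?H (x, \<omega>) \<partial>M) = (\<integral>\<^sup>+\<omega>. 0 \<partial>M)"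
      using E.AE_not_in_points[of x] by (intro nn_integral_cong_AE, eventually_elim) simp
    then show ?thesis by simp
  qed
  have "(\<Sum>i. \<integral>\<^sup>+\<omega>. ?H (X i \<omega>, \<omega>) \<partial>M) = 0"
    unfolding campbell[OF X H] zero by simp
  then have int0: "(\<integral>\<^sup>+\<omega>. ?H (X i \<omega>, \<omega>) \<partial>M) = 0" for i
    by (simp add: suminf_eq_zero_iff)
  have "AE \<omega> in M. ?H (X i \<omega>, \<omega>) = 0" for i
  proof -
    note enumerates_measurable[OF X, measurable] E.measurable_ident_F [measurable]
    have "(\<lambda>\<omega>. ?H (X i \<omega>, \<omega>)) \<in> borel_measurable M"
      by (rule measurable_compose[OF _ H]) measurable
    from nn_integral_0_iff_AE[OF this, THEN iffD1, OF int0] show ?thesis .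
  qed
  then have "AE \<omega> in M. \<forall>i. ?H (X i \<omega>, \<omega>) = 0"
    by (simp add: AE_all_countable)
  moreover have "AE \<omega> in M. range (\<lambda>i. X i \<omega>) = Pl \<omega>"
    using X by (auto simp: enumerates_def)
  ultimately show ?thesis
  proof eventually_elim
    case (elim \<omega>)
    have "X i \<omega> \<notin> Pe \<omega>" for i
      using elim(1) by (cases "X i \<omega> \<in> Pe \<omega>") (auto dest: spec[of _ i])
    then show ?case
      unfolding elim(2)[symmetric] by auto
  qed
qed

end

subsection \<open>Independent marks\<close>

lemma measurable_pred_quad:
  assumes S: "Measurable.pred (A \<Otimes>\<^sub>M B \<Otimes>\<^sub>M C \<Otimes>\<^sub>M D) (\<lambda>(x, y, v, w). S x y v w)"
    and [measurable]: "a \<in> measurable N A" "b \<in> measurable N B" "c \<in> measurable N C" "d \<in> measurable N D"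
  shows "Measurable.pred N (\<lambda>q. S (a q) (b q) (c q) (d q))"
proof -
  have "(\<lambda>q. (a q, b q, c q, d q)) \<in> measurable N (A \<Otimes>\<^sub>M B \<Otimes>\<^sub>M C \<Otimes>\<^sub>M D)"
    by measurable
  from measurable_compose[OF this S] show ?thesis
    by simp
qed

lemma (in prob_space) emeasure_compl_pred:
  assumes "Measurable.pred M Q" and [simp]: "space M = UNIV"
  shows "1 - emeasure M {v. Q v} = emeasure M {v. \<not> Q v}"
proof -
  have "{v. Q v} \<in> sets M"
    using assms by (simp add: pred_def)
  from emeasure_compl[OF this] have "emeasure M (- {v. Q v}) = emeasure M (space M) - emeasure M {v. Q v}"
    by (simp add: Compl_eq_Diff_UNIV)
  then show ?thesis
    unfolding emeasure_space_1 by (simp add: Collect_neg_eq)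
qed

text \<open>Once the coordinate \<open>s\<close>, shared by all conditions, is fixed to
  \<open>w\<close>, the conditions concern different independent coordinates and their probabilities
  multiply. The infinite product is the decreasing limit of finite ones, written with
  \<open>nexp\<close> and \<open>nln\<close>; the integral over \<open>w\<close> comes last.\<close>

lemma emeasure_PiM_all_pairs:
  fixes D :: "real measure" and l :: "nat \<Rightarrow> 'i" and S :: "nat \<Rightarrow> real \<Rightarrow> real \<Rightarrow> bool"
  assumes D: "prob_space D" and sets_D [measurable_cong]: "sets D = sets borel"
    and l: "inj l" "range l \<subseteq> I" and s: "s \<in> I" "s \<notin> range l"
    and S [measurable]: "\<And>j. Measurable.pred (borel \<Otimes>\<^sub>M borel) (\<lambda>(v, w). S j v w)"
  shows "emeasure (\<Pi>\<^sub>M i\<in>I. D) {\<zeta>\<in>space (\<Pi>\<^sub>M i\<in>I. D). \<forall>j. S j (\<zeta> (l j)) (\<zeta> s)}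
      = (\<integral>\<^sup>+w. nexp (\<Sum>j. nln (emeasure D {v. S j v w})) \<partial>D)"
proof -
  interpret D: prob_space D by fact
  interpret product_prob_space "\<lambda>_. D" I
    by unfold_locales
  let ?P = "\<lambda>J. \<Pi>\<^sub>M i\<in>J. D"
  let ?A = "\<lambda>n J. {\<zeta>\<in>space (?P J). \<forall>j<n. S j (\<zeta> (l j)) (\<zeta> s)}"
  have space_D [simp]: "space D = UNIV"
    using sets_eq_imp_space_eq[OF sets_D] by simp
  have lI: "l j \<in> I" for j using l by auto
  have A: "?A n J \<in> sets (?P J)" if "s \<in> J" "\<And>j. j < n \<Longrightarrow> l j \<in> J" for n J
  proof -
    have [measurable]: "(\<lambda>\<zeta>. \<zeta> s) \<in> borel_measurable (?P J)"
      using measurable_component_singleton[OF that(1), of "\<lambda>_. D"]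
      unfolding measurable_cong_sets[OF refl sets_D] .
    have "(\<lambda>\<zeta>. \<zeta> (l j)) \<in> borel_measurable (?P J)" if "j < n" for j
      using measurable_component_singleton[OF \<open>\<And>j. j < n \<Longrightarrow> l j \<in> J\<close>[OF that], of "\<lambda>_. D"]
      unfolding measurable_cong_sets[OF refl sets_D] .
    then have single: "{\<zeta>\<in>space (?P J). S j (\<zeta> (l j)) (\<zeta> s)} \<in> sets (?P J)" if "j < n" for j
      using that by measurable
    have "{\<zeta>\<in>space (?P J). \<forall>j\<in>{..<n}. S j (\<zeta> (l j)) (\<zeta> s)} \<in> sets (?P J)"
      by (rule sets.sets_Collect_finite_All) (simp_all add: single)
    then show ?thesis by (simp only: lessThan_iff Ball_def)
  qed
  have meas_D [measurable]: "(\<lambda>w. emeasure D {v. S j v w}) \<in> borel_measurable borel" for j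
  proof -
    have "(\<lambda>p. (snd p, fst p)) \<in> measurable (borel \<Otimes>\<^sub>M D) (borel \<Otimes>\<^sub>M borel)"
      by measurable
    from measurable_compose[OF this S[of j]]
    have "{p \<in> space (borel \<Otimes>\<^sub>M D). S j (snd p) (fst p)} \<in> sets (borel \<Otimes>\<^sub>M D)"
      by (simp add: pred_def)
    from D.measurable_emeasure_Pair[OF this] show ?thesis
      by (simp add: vimage_def space_pair_measure)
  qed
  \<comment> \<open>The first \<open>n\<close> conditions involve finitely many coordinates, so they
    can be computed in a finite product from which the coordinate \<open>s\<close> splits
    off.\<close>
  have finite: "emeasure (?P I) (?A n I) = (\<integral>\<^sup>+w. nexp (\<Sum>j<n. nln (emeasure D {v. S j v w})) \<partial>D)" for n
  proof -
    let ?L = "l ` {..<n}" and ?J = "insert s (l ` {..<n})"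
    have J: "finite ?L" "s \<notin> ?L" "?J \<subseteq> I" using l s by auto
    have "emeasure (?P ?J) (?A n ?J) = emeasure (distr (?P I) (?P ?J) (\<lambda>\<zeta>. restrict \<zeta> ?J)) (?A n ?J)"
      using J by (subst distr_PiM_restrict_finite) auto
    also have "\<dots> = emeasure (?P I) ((\<lambda>\<zeta>. restrict \<zeta> ?J) -` ?A n ?J \<inter> space (?P I))"
      using J by (intro emeasure_distr measurable_restrict_subset A) auto
    also have "(\<lambda>\<zeta>. restrict \<zeta> ?J) -` ?A n ?J \<inter> space (?P I) = ?A n I"
      using J by (auto simp: space_PiM)
    finally have "emeasure (?P I) (?A n I) = (\<integral>\<^sup>+\<zeta>. indicator (?A n ?J) \<zeta> \<partial>?P ?J)"
      using A[of ?J n] by simp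
    also have "\<dots> = (\<integral>\<^sup>+w. \<integral>\<^sup>+\<zeta>. indicator (?A n ?J) (\<zeta>(s := w)) \<partial>?P ?L \<partial>D)"
      using J A[of ?J n] by (intro product_nn_integral_insert_rev) auto
    also have "\<dots> = (\<integral>\<^sup>+w. nexp (\<Sum>j<n. nln (emeasure D {v. S j v w})) \<partial>D)"
    proof (rule nn_integral_cong)
      fix w
      \<comment> \<open>For fixed \<open>w\<close> the event is a box; since \<open>l\<close> is
        injective, \<open>inv l\<close> recovers the condition that belongs to a coordinate.\<close>
      let ?B = "\<lambda>i. {v. S (inv l i) v w}"
      have B: "?B i \<in> sets D" for i
        by measurable
      have "(\<integral>\<^sup>+\<zeta>. indicator (?A n ?J) (\<zeta>(s := w)) \<partial>?P ?L) = (\<integral>\<^sup>+\<zeta>. indicator (Pi\<^sub>E ?L ?B) \<zeta> \<partial>?P ?L)"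
        using J l by (intro nn_integral_cong)
          (auto simp: space_PiM PiE_iff fun_upd_def extensional_def split: split_indicator)
      also have "\<dots> = (\<Prod>i\<in>?L. emeasure D (?B i))"
        using J B by (simp add: emeasure_PiM sets_PiM_I_finite)
      also have "\<dots> = (\<Prod>j<n. emeasure D {v. S j v w})"
        using l by (subst prod.reindex) (auto simp: inj_on_def)
      also have "\<dots> = nexp (\<Sum>j<n. nln (emeasure D {v. S j v w}))"
        by (simp add: nexp_sum nexp_nln D.emeasure_le_1)
      finally show "(\<integral>\<^sup>+\<zeta>. indicator (?A n ?J) (\<zeta>(s := w)) \<partial>?P ?L)
          = nexp (\<Sum>j<n. nln (emeasure D {v. S j v w}))" .
    qed
    finally show ?thesis .
  qed
  have "{\<zeta>\<in>space (?P I). \<forall>j. S j (\<zeta> (l j)) (\<zeta> s)} = (\<Inter>n. ?A n I)"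
    by auto
  also have "emeasure (?P I) \<dots> = (INF n. emeasure (?P I) (?A n I))"
    using s lI by (intro INF_emeasure_decseq[symmetric]) (auto intro!: A simp: decseq_def)
  also have "\<dots> = (\<integral>\<^sup>+w. (INF n. nexp (\<Sum>j<n. nln (emeasure D {v. S j v w}))) \<partial>D)"
    unfolding finite
  proof (rule nn_integral_monotone_convergence_INF_AE'[symmetric])
    show "AE w in D. nexp (\<Sum>j<Suc n. nln (emeasure D {v. S j v w})) \<le> nexp (\<Sum>j<n. nln (emeasure D {v. S j v w}))" for n
      by (intro AE_I2 nexp_antimono) simp
  qed (simp_all add: D.emeasure_space_1[simplified])
  finally show ?thesis
    by (simp add: nexp_SUP[symmetric] suminf_eq_SUP)
qed

section \<open>Marks on labelled pairs, with the enumerations fixed\<close>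

locale marked_ppp_pair = planar_ppp_pair M lam_l Pl lam_e Pe
  for M :: "'w measure" and lam_l Pl lam_e Pe +
  fixes X Y :: "nat \<Rightarrow> 'w \<Rightarrow> point" and Z :: "'w \<Rightarrow> point set \<Rightarrow> real" and f :: "real \<Rightarrow> real"
  assumes X: "enumerates M X Pl" and Y: "enumerates M Y Pe"
    and indep_marks: "L.indep_vars (\<lambda>_. borel) (link_mark X Y Z) links"
    and distributed_marks: "\<And>s. s \<in> links \<Longrightarrow> distributed M lborel (link_mark X Y Z s) (\<lambda>z. ennreal (f z))"
    and marks_pos: "\<And>s. s \<in> links \<Longrightarrow> AE \<omega> in M. link_mark X Y Z s \<omega> > 0"
    and indep_positions_marks: "L.indep_set
          (sets (vimage_algebra (space M) (position X Y) (Pi\<^sub>M UNIV (\<lambda>_. borel))))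
          (sets (vimage_algebra (space M) (\<lambda>\<omega>. \<lambda>s\<in>links. link_mark X Y Z s \<omega>)
                   (Pi\<^sub>M links (\<lambda>_. borel))))"
begin

definition D :: "real measure" where "D = density lborel (\<lambda>z. ennreal (f z))"

lemma sets_D [measurable_cong, simp]: "sets D = sets borel"
  by (simp add: D_def)

lemma space_D [simp]: "space D = UNIV"
  by (simp add: D_def)

lemma links_Legit: "{Origin, Legit i} \<in> links" and links_Eaves: "{Origin, Eaves j} \<in> links"
  and links_Legit_Eaves: "{Legit i, Eaves j} \<in> links"
  unfolding links_def by blast+

lemma measurable_mark: "s \<in> links \<Longrightarrow> link_mark X Y Z s \<in> borel_measurable M"
  using indep_marks by (auto simp: L.indep_vars_def)

lemma distr_mark: "s \<in> links \<Longrightarrow> distr M borel (link_mark X Y Z s) = D"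
  using distributed_distr_eq_density[OF distributed_marks, of s]
  by (simp add: D_def distr_cong[OF refl sets_lborel[symmetric]])

sublocale D: prob_space D
proof -
  have "prob_space (distr M borel (link_mark X Y Z {Origin, Legit 0}))"
    by (rule L.prob_space_distr measurable_mark links_Legit)+
  then show "prob_space D"
    by (simp add: distr_mark links_Legit)
qed

lemma AE_D_pos: "AE v in D. v > 0"
proof -
  have "AE v in distr M borel (link_mark X Y Z {Origin, Legit 0}). v > 0"
    using marks_pos[OF links_Legit, of 0]
    by (subst AE_distr_iff) (simp_all add: measurable_mark links_Legit)
  then show ?thesis
    unfolding distr_mark[OF links_Legit] .
qed

lemma measurable_X [measurable]: "X i \<in> borel_measurable M"
  and measurable_Y [measurable]: "Y i \<in> borel_measurable M"
  by (rule enumerates_measurable[OF X] enumerates_measurable[OF Y])+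

lemma measurable_positions: "position X Y \<in> measurable M (Pi\<^sub>M UNIV (\<lambda>_. borel))"
proof (rule measurable_PiM_single')
  show "(\<lambda>\<omega>. position X Y \<omega> p) \<in> borel_measurable M" for p
    by (cases p) simp_all
qed auto

lemma measurable_marks: "(\<lambda>\<omega>. \<lambda>s\<in>links. link_mark X Y Z s \<omega>) \<in> measurable M (Pi\<^sub>M links (\<lambda>_. borel))"
  by (intro measurable_restrict measurable_mark)

text \<open>This is what conditioning on the positions amounts to: independence of positions and
  marks gives the outer product, independence of the marks among themselves the inner one.\<close>

lemma distr_positions_marks:
  "distr M (Pi\<^sub>M UNIV (\<lambda>_. borel) \<Otimes>\<^sub>M Pi\<^sub>M links (\<lambda>_. borel))
      (\<lambda>\<omega>. (position X Y \<omega>, \<lambda>s\<in>links. link_mark X Y Z s \<omega>))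
    = distr M (Pi\<^sub>M UNIV (\<lambda>_. borel)) (position X Y) \<Otimes>\<^sub>M Pi\<^sub>M links (\<lambda>_. D)"
proof -
  let ?U = "Pi\<^sub>M UNIV (\<lambda>_::label. borel :: point measure)" and ?V = "Pi\<^sub>M links (\<lambda>_. borel :: real measure)"
  let ?m = "\<lambda>\<omega>. \<lambda>s\<in>links. link_mark X Y Z s \<omega>"
  note measurable_positions [measurable] measurable_marks [measurable]
  have "distr M ?U (position X Y) \<Otimes>\<^sub>M distr M ?V ?m = distr M (?U \<Otimes>\<^sub>M ?V) (\<lambda>\<omega>. (position X Y \<omega>, ?m \<omega>))"
  proof (rule pair_measure_eqI)
    show "sigma_finite_measure (distr M ?U (position X Y))" "sigma_finite_measure (distr M ?V ?m)"
      by (intro prob_space_imp_sigma_finite L.prob_space_distr measurable_positions measurable_marks)+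
    fix A B assume "A \<in> sets (distr M ?U (position X Y))" "B \<in> sets (distr M ?V ?m)"
    then have AB [measurable]: "A \<in> sets ?U" "B \<in> sets ?V" by simp_all
    have "L.prob ((position X Y -` A \<inter> space M) \<inter> (?m -` B \<inter> space M))
        = L.prob (position X Y -` A \<inter> space M) * L.prob (?m -` B \<inter> space M)"
      using indep_positions_marks by (rule L.indep_setD) (rule in_vimage_algebra, fact)+
    moreover have "(\<lambda>\<omega>. (position X Y \<omega>, ?m \<omega>)) -` (A \<times> B) \<inter> space M
        = (position X Y -` A \<inter> space M) \<inter> (?m -` B \<inter> space M)"
      by auto
    ultimately show "emeasure (distr M ?U (position X Y)) A * emeasure (distr M ?V ?m) B
        = emeasure (distr M (?U \<Otimes>\<^sub>M ?V) (\<lambda>\<omega>. (position X Y \<omega>, ?m \<omega>))) (A \<times> B)"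
      by (simp add: emeasure_distr L.emeasure_eq_measure ennreal_mult)
  qed simp
  moreover have "distr M (Pi\<^sub>M links (\<lambda>_. borel)) (\<lambda>\<omega>. \<lambda>s\<in>links. link_mark X Y Z s \<omega>) = Pi\<^sub>M links (\<lambda>_. D)"
  proof -
    have "links \<noteq> {}" using links_Legit by auto
    then have "distr M (Pi\<^sub>M links (\<lambda>_. borel)) (\<lambda>\<omega>. \<lambda>s\<in>links. link_mark X Y Z s \<omega>)
        = Pi\<^sub>M links (\<lambda>s. distr M borel (link_mark X Y Z s))"
      using indep_marks by (subst L.indep_vars_iff_distr_eq_PiM'[symmetric]) (auto intro: measurable_mark)
    also have "\<dots> = Pi\<^sub>M links (\<lambda>_. D)"
      by (intro PiM_cong refl distr_mark)
    finally show ?thesis .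
  qed
  ultimately show ?thesis
    by simp
qed

text \<open>With the positions frozen, only the mark vector is random and
  \<open>emeasure_PiM_all_pairs\<close> applies. The sum over labels then becomes a sum over the
  point set, which removes the enumeration \<open>Y\<close>. The labelling \<open>l\<close> is kept
  general because the eavesdropper links start at the origin for out-edges and at
  \<open>Legit i\<close> for in-edges.\<close>

lemma emeasure_all_links:
  fixes S :: "point \<Rightarrow> point \<Rightarrow> real \<Rightarrow> real \<Rightarrow> bool" and l :: "nat \<Rightarrow> label set"
  assumes S [measurable]: "Measurable.pred (borel \<Otimes>\<^sub>M borel \<Otimes>\<^sub>M borel \<Otimes>\<^sub>M borel) (\<lambda>(x, y, v, w). S x y v w)"
    and l: "inj l" "range l \<subseteq> links" and s: "s \<in> links" "s \<notin> range l"
  shows "emeasure M {\<omega>\<in>space M. \<forall>j. S (X i \<omega>) (Y j \<omega>) (link_mark X Y Z (l j) \<omega>) (link_mark X Y Z s \<omega>)}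
    = (\<integral>\<^sup>+\<omega>. \<integral>\<^sup>+w. nexp (\<integral>\<^sup>+y. nln (emeasure D {v. S (X i \<omega>) y v w}) \<partial>count_space (Pe \<omega>)) \<partial>D \<partial>M)"
proof -
  let ?U = "Pi\<^sub>M UNIV (\<lambda>_::label. borel :: point measure)" and ?V = "Pi\<^sub>M links (\<lambda>_. borel :: real measure)"
  let ?m = "\<lambda>\<omega>. \<lambda>s\<in>links. link_mark X Y Z s \<omega>"
  interpret PD: product_prob_space "\<lambda>_. D" links
    by unfold_locales
  have sets_PD [measurable_cong]: "sets (Pi\<^sub>M links (\<lambda>_. D)) = sets ?V"
    by (intro sets_PiM_cong) simp_all
  have lI: "l j \<in> links" for j using l by auto
  have pm [measurable]: "(\<lambda>\<omega>. (position X Y \<omega>, ?m \<omega>)) \<in> measurable M (?U \<Otimes>\<^sub>M ?V)"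
    using measurable_positions measurable_marks by (rule measurable_Pair)
  define B where "B = {q \<in> space (?U \<Otimes>\<^sub>M ?V). \<forall>j. S (fst q (Legit i)) (fst q (Eaves j)) (snd q (l j)) (snd q s)}"
  have B [measurable]: "B \<in> sets (?U \<Otimes>\<^sub>M ?V)"
  proof -
    have [measurable]: "(\<lambda>q. snd q (l j)) \<in> borel_measurable (?U \<Otimes>\<^sub>M ?V)"
        "(\<lambda>q. snd q s) \<in> borel_measurable (?U \<Otimes>\<^sub>M ?V)"
        "(\<lambda>q. fst q p) \<in> borel_measurable (?U \<Otimes>\<^sub>M ?V)" for j p
      by (rule measurable_compose[OF measurable_snd measurable_component_singleton] lI s
          measurable_compose[OF measurable_fst measurable_component_singleton] UNIV_I)+
    note measurable_pred_quad[OF S, measurable]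
    show ?thesis
      unfolding B_def by measurable
  qed
  have "{\<omega>\<in>space M. \<forall>j. S (X i \<omega>) (Y j \<omega>) (link_mark X Y Z (l j) \<omega>) (link_mark X Y Z s \<omega>)}
      = (\<lambda>\<omega>. (position X Y \<omega>, ?m \<omega>)) -` B \<inter> space M"
    using lI s by (auto simp: B_def space_pair_measure space_PiM)
  then have "emeasure M {\<omega>\<in>space M. \<forall>j. S (X i \<omega>) (Y j \<omega>) (link_mark X Y Z (l j) \<omega>) (link_mark X Y Z s \<omega>)}
      = emeasure (distr M (?U \<Otimes>\<^sub>M ?V) (\<lambda>\<omega>. (position X Y \<omega>, ?m \<omega>))) B"
    by (simp add: emeasure_distr)
  also have "\<dots> = emeasure (distr M ?U (position X Y) \<Otimes>\<^sub>M Pi\<^sub>M links (\<lambda>_. D)) B"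
    by (simp add: distr_positions_marks)
  also have "\<dots> = (\<integral>\<^sup>+p. emeasure (Pi\<^sub>M links (\<lambda>_. D)) (Pair p -` B) \<partial>distr M ?U (position X Y))"
    by (rule PD.P.emeasure_pair_measure_alt) measurable
  also have "\<dots> = (\<integral>\<^sup>+\<omega>. emeasure (Pi\<^sub>M links (\<lambda>_. D)) (Pair (position X Y \<omega>) -` B) \<partial>M)"
    by (intro nn_integral_distr measurable_positions PD.P.measurable_emeasure_Pair) measurable
  also have "\<dots> = (\<integral>\<^sup>+\<omega>. \<integral>\<^sup>+w. nexp (\<Sum>j. nln (emeasure D {v. S (X i \<omega>) (Y j \<omega>) v w})) \<partial>D \<partial>M)"
  proof (rule nn_integral_cong)
    fix \<omega> assume "\<omega> \<in> space M"
    have "Pair (position X Y \<omega>) -` B = {\<zeta>\<in>space (Pi\<^sub>M links (\<lambda>_. D)). \<forall>j. S (X i \<omega>) (Y j \<omega>) (\<zeta> (l j)) (\<zeta> s)}"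
      by (auto simp: B_def space_pair_measure space_PiM)
    also have "emeasure (Pi\<^sub>M links (\<lambda>_. D)) \<dots> = (\<integral>\<^sup>+w. nexp (\<Sum>j. nln (emeasure D {v. S (X i \<omega>) (Y j \<omega>) v w})) \<partial>D)"
      using l s by (intro emeasure_PiM_all_pairs D.prob_space_axioms) auto
    finally show "emeasure (Pi\<^sub>M links (\<lambda>_. D)) (Pair (position X Y \<omega>) -` B)
        = (\<integral>\<^sup>+w. nexp (\<Sum>j. nln (emeasure D {v. S (X i \<omega>) (Y j \<omega>) v w})) \<partial>D)" .
  qed
  also have "\<dots> = (\<integral>\<^sup>+\<omega>. \<integral>\<^sup>+w. nexp (\<integral>\<^sup>+y. nln (emeasure D {v. S (X i \<omega>) y v w}) \<partial>count_space (Pe \<omega>)) \<partial>D \<partial>M)"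
  proof (rule nn_integral_cong_AE, use enumerates_suminf[OF Y] in eventually_elim)
    case (elim \<omega>)
    have "(\<Sum>j. nln (emeasure D {v. S (X i \<omega>) (Y j \<omega>) v w}))
        = (\<integral>\<^sup>+y. nln (emeasure D {v. S (X i \<omega>) y v w}) \<partial>count_space (Pe \<omega>))" for w
      using elim[rule_format, of "\<lambda>y. nln (emeasure D {v. S (X i \<omega>) y v w})"] .
    then show ?case
      by simp
  qed
  finally show ?thesis .
qed

text \<open>The void probability of the marked eavesdroppers: the condition \<open>S\<close> fails
  for no point exactly if the marked process misses the complement of \<open>S\<close>, whose
  intensity stands in the exponent.\<close>

lemma emeasure_void:
  fixes S :: "point \<Rightarrow> real \<Rightarrow> bool" and l :: "nat \<Rightarrow> label set"
  assumes S [measurable]: "Measurable.pred (borel \<Otimes>\<^sub>M borel) (\<lambda>(y, v). S y v)"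
    and l: "inj l" "range l \<subseteq> links" and s: "s \<in> links" "s \<notin> range l"
  shows "emeasure M {\<omega>\<in>space M. \<forall>j. S (Y j \<omega>) (link_mark X Y Z (l j) \<omega>)}
    = nexp (ennreal lam_e * (\<integral>\<^sup>+y. emeasure D {v. \<not> S y v} \<partial>lborel))"
proof -
  have [measurable]: "(\<lambda>y. emeasure D {v. S y v}) \<in> borel_measurable borel"
  proof -
    have "{p \<in> space (borel \<Otimes>\<^sub>M D). S (fst p) (snd p)} \<in> sets (borel \<Otimes>\<^sub>M D)"
      by measurable
    from D.measurable_emeasure_Pair[OF this] show ?thesis
      by (simp add: vimage_def space_pair_measure)
  qed
  have compl: "1 - emeasure D {v. S y v} = emeasure D {v. \<not> S y v}" for y
    by (rule D.emeasure_compl_pred) simp_all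
  have "emeasure M {\<omega>\<in>space M. \<forall>j. S (Y j \<omega>) (link_mark X Y Z (l j) \<omega>)}
      = (\<integral>\<^sup>+\<omega>. \<integral>\<^sup>+w. nexp (\<integral>\<^sup>+y. nln (emeasure D {v. S y v}) \<partial>count_space (Pe \<omega>)) \<partial>D \<partial>M)"
    using l s by (intro emeasure_all_links[where S = "\<lambda>x y v w. S y v" and s = s]) measurable
  also have "\<dots> = (\<integral>\<^sup>+\<omega>. nexp (\<integral>\<^sup>+y. nln (emeasure D {v. S y v}) \<partial>count_space (Pe \<omega>)) \<partial>M)"
    by (simp add: D.emeasure_space_1[simplified])
  also have "\<dots> = nexp (ennreal lam_e * (\<integral>\<^sup>+y. emeasure D {v. \<not> S y v} \<partial>lborel))"
    by (subst E.generating_functional) (simp_all add: nexp_nln D.emeasure_le_1 compl)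
  finally show ?thesis .
qed

text \<open>Campbell's formula replaces the random node by a fixed \<open>x\<close>. The integrals
  over the mark \<open>w\<close> and the outcome are then exchanged, because the generating
  functional of the eavesdroppers needs \<open>x\<close> and \<open>w\<close> frozen.\<close>

lemma sum_emeasure_all_links:
  fixes S :: "point \<Rightarrow> point \<Rightarrow> real \<Rightarrow> real \<Rightarrow> bool" and l :: "nat \<Rightarrow> nat \<Rightarrow> label set"
  assumes S [measurable]: "Measurable.pred (borel \<Otimes>\<^sub>M borel \<Otimes>\<^sub>M borel \<Otimes>\<^sub>M borel) (\<lambda>(x, y, v, w). S x y v w)"
    and l: "\<And>i. inj (l i)" "\<And>i. range (l i) \<subseteq> links" and s: "\<And>i. s i \<in> links" "\<And>i. s i \<notin> range (l i)"
  shows "(\<Sum>i. emeasure M {\<omega>\<in>space M. \<forall>j.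
        S (X i \<omega>) (Y j \<omega>) (link_mark X Y Z (l i j) \<omega>) (link_mark X Y Z (s i) \<omega>)})
    = ennreal lam_l * (\<integral>\<^sup>+x. \<integral>\<^sup>+w.
        nexp (ennreal lam_e * (\<integral>\<^sup>+y. emeasure D {v. \<not> S x y v w} \<partial>lborel)) \<partial>D \<partial>lborel)"
proof -
  interpret MD: pair_sigma_finite M D
    by unfold_locales
  note measurable_pred_quad[OF S, measurable]
  have meas [measurable]: "(\<lambda>q. emeasure D {v. S (fst (fst q)) (snd q) v (snd (fst q))})
      \<in> borel_measurable ((borel \<Otimes>\<^sub>M borel) \<Otimes>\<^sub>M borel)"
  proof -
    have "{p \<in> space (((borel \<Otimes>\<^sub>M borel) \<Otimes>\<^sub>M borel) \<Otimes>\<^sub>M D).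
        S (fst (fst (fst p))) (snd (fst p)) (snd p) (snd (fst (fst p)))}
        \<in> sets (((borel \<Otimes>\<^sub>M borel) \<Otimes>\<^sub>M borel) \<Otimes>\<^sub>M D)"
      by measurable
    from D.measurable_emeasure_Pair[OF this] show ?thesis
      by (simp add: vimage_def space_pair_measure)
  qed
  have compl: "1 - emeasure D {v. S x y v w} = emeasure D {v. \<not> S x y v w}" for x y w
    by (rule D.emeasure_compl_pred) (simp_all add: measurable_pred_quad[OF S])
  \<comment> \<open>The conditional probability that all links satisfy \<open>S\<close>, given the
    eavesdroppers, the node at \<open>x\<close> and the shared mark \<open>w\<close>. It depends on
    \<omega> only through \<open>Pe\<close>, as Campbell's formula requires.\<close>
  define K where "K x w \<omega> = nexp (\<integral>\<^sup>+y. nln (emeasure D {v. S x y v w}) \<partial>count_space (Pe \<omega>))" for x w \<omega>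
  have K [measurable]: "(\<lambda>p. K (fst (fst p)) (snd (fst p)) (snd p)) \<in> borel_measurable ((borel \<Otimes>\<^sub>M borel) \<Otimes>\<^sub>M E.F)"
    unfolding K_def
    using E.measurable_points_integral[of "\<lambda>q. nln (emeasure D {v. S (fst (fst q)) (snd q) v (snd (fst q))})" "borel \<Otimes>\<^sub>M borel"]
    by simp
  have K1: "(\<lambda>p. K (fst (fst p)) (snd p) (snd (fst p))) \<in> borel_measurable ((borel \<Otimes>\<^sub>M E.F) \<Otimes>\<^sub>M D)"
    using measurable_compose[of "\<lambda>p. ((fst (fst p), snd p), snd (fst p))" "(borel \<Otimes>\<^sub>M E.F) \<Otimes>\<^sub>M D", OF _ K]
    by simp
  have "(\<lambda>p. \<integral>\<^sup>+w. K (fst p) w (snd p) \<partial>D) \<in> borel_measurable (borel \<Otimes>\<^sub>M E.F)"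
    using D.borel_measurable_nn_integral_fst[OF K1] by simp
  note H = this
  have "(\<Sum>i. emeasure M {\<omega>\<in>space M. \<forall>j.
        S (X i \<omega>) (Y j \<omega>) (link_mark X Y Z (l i j) \<omega>) (link_mark X Y Z (s i) \<omega>)})
      = (\<Sum>i. \<integral>\<^sup>+\<omega>. \<integral>\<^sup>+w. K (X i \<omega>) w \<omega> \<partial>D \<partial>M)"
    unfolding K_def using l s by (intro suminf_cong emeasure_all_links) auto
  also have "\<dots> = ennreal lam_l * (\<integral>\<^sup>+x. \<integral>\<^sup>+\<omega>. \<integral>\<^sup>+w. K x w \<omega> \<partial>D \<partial>M \<partial>lborel)"
    using campbell[OF X H] by simp
  also have "(\<integral>\<^sup>+x. \<integral>\<^sup>+\<omega>. \<integral>\<^sup>+w. K x w \<omega> \<partial>D \<partial>M \<partial>lborel) = (\<integral>\<^sup>+x. \<integral>\<^sup>+w. \<integral>\<^sup>+\<omega>. K x w \<omega> \<partial>M \<partial>D \<partial>lborel)"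
  proof (intro nn_integral_cong MD.Fubini'[symmetric])
    fix x :: point
    have "(\<lambda>q. ((x, snd q), fst q)) \<in> measurable (M \<Otimes>\<^sub>M D) ((borel \<Otimes>\<^sub>M borel) \<Otimes>\<^sub>M E.F)"
      using E.measurable_ident_F measurable_compose[OF measurable_fst, of "\<lambda>\<omega>. \<omega>" M E.F]
      by measurable
    from measurable_compose[OF this K]
    show "(\<lambda>(\<omega>, w). K x w \<omega>) \<in> borel_measurable (M \<Otimes>\<^sub>M D)"
      by (simp add: case_prod_beta')
  qed
  also have "\<dots> = (\<integral>\<^sup>+x. \<integral>\<^sup>+w.
        nexp (ennreal lam_e * (\<integral>\<^sup>+y. emeasure D {v. \<not> S x y v w} \<partial>lborel)) \<partial>D \<partial>lborel)"
  proof (intro nn_integral_cong)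
    fix x w
    have "(\<lambda>y. emeasure D {v. S x y v w}) \<in> borel_measurable borel"
      using measurable_compose[OF _ meas, of "\<lambda>y. ((x, w), y)" borel] by simp
    then show "(\<integral>\<^sup>+\<omega>. K x w \<omega> \<partial>M) = nexp (ennreal lam_e * (\<integral>\<^sup>+y. emeasure D {v. \<not> S x y v w} \<partial>lborel))"
      unfolding K_def by (subst E.generating_functional) (simp_all add: nexp_nln D.emeasure_le_1 compl)
  qed
  finally show ?thesis .
qed

end

subsection \<open>Gains and degrees\<close>

text \<open>The values of \<open>g\<close> at \<open>r \<le> 0\<close> or \<open>z \<le> 0\<close> are unconstrained; replacing them by 0 makes the
  gain jointly Borel and changes it only on null events.\<close>

definition clipped :: "(real \<Rightarrow> real \<Rightarrow> real) \<Rightarrow> real \<Rightarrow> real \<Rightarrow> real" where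
  "clipped g r z = (if r > 0 \<and> z > 0 then g r z else 0)"

context
  fixes g :: "real \<Rightarrow> real \<Rightarrow> real"
  assumes g: "power_gain_function g"
begin

lemma gain_strict_antimono: "z > 0 \<Longrightarrow> 0 < q \<Longrightarrow> q < r \<Longrightarrow> g r z < g q z"
  using g unfolding power_gain_function_def
  by (auto dest!: spec[of _ z] dest: monotone_onD[of _ _ _ _ q r])

lemma clipped_nonneg: "0 \<le> clipped g r z"
  using g by (simp add: clipped_def power_gain_function_def less_imp_le)

lemma gain_less_rational:
  assumes "z > 0" "r > 0" "g r z < t"
  shows "\<exists>q\<in>\<rat>. 0 < q \<and> q < r \<and> g q z < t"
proof -
  have "continuous_on {0<..} (\<lambda>r. g r z)"
    using g assms by (simp add: power_gain_function_def)
  then have "isCont (\<lambda>r. g r z) r"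
    using assms by (simp add: continuous_on_eq_continuous_at)
  then have "((\<lambda>r. g r z) \<longlongrightarrow> g r z) (at_left r)"
    unfolding isCont_def by (rule filterlim_mono) (auto simp: at_within_le_at)
  then have "eventually (\<lambda>q. g q z < t) (at_left r)"
    using assms by (intro order_tendstoD)
  then obtain b where b: "b < r" "\<And>q. b < q \<Longrightarrow> q < r \<Longrightarrow> g q z < t"
    by (auto simp: eventually_at_left[of "r - 1" r])
  obtain q where "q \<in> \<rat>" "max 0 b < q" "q < r"
    using Rats_dense_in_real[of "max 0 b" r] b assms by auto
  then show ?thesis
    using b by auto
qed

text \<open>Measurability of \<open>g\<close> in the mark is given only for each fixed distance.
  Left continuity and monotonicity in the distance make it joint: for positive arguments,
  \<open>g r z < t\<close> holds iff \<open>g q z < t\<close> for some positive rational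
  \<open>q < r\<close>, a countable union of measurable rectangles.\<close>

lemma measurable_clipped: "(\<lambda>p. clipped g (fst p) (snd p)) \<in> borel_measurable (borel \<Otimes>\<^sub>M borel)"
proof (rule borel_measurableI_less)
  fix t
  define u where "u q z = (if z > 0 then g q z else 0)" for q z
  have u: "u q \<in> borel_measurable borel" if "q > 0" for q
  proof -
    have "g q \<in> borel_measurable (restrict_space borel {0<..})"
      using g that by (simp add: power_gain_function_def)
    then have "(\<lambda>z. if z \<in> {0<..} then g q z else 0) \<in> borel_measurable borel"
      by (subst (asm) measurable_restrict_space_iff[where c = 0]) auto
    then show ?thesis by (simp add: u_def[abs_def])
  qed
  have "clipped g r z < t \<longleftrightarrow> (if r > 0 \<and> z > 0
      then \<exists>q\<in>{q\<in>\<rat>. 0 < q}. q < r \<and> u q z < t else 0 < t)" for r z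
  proof (cases "r > 0 \<and> z > 0")
    case True
    have "g r z < t" if "0 < q" "q < r" "g q z < t" for q
      using gain_strict_antimono[of z q r] True that by simp
    then show ?thesis
      using True gain_less_rational[of z r t] by (auto simp: clipped_def u_def)
  qed (auto simp: clipped_def)
  then have "{p \<in> space (borel \<Otimes>\<^sub>M borel). clipped g (fst p) (snd p) < t}
      = {p \<in> space (borel \<Otimes>\<^sub>M borel). if fst p > 0 \<and> snd p > 0
          then \<exists>q\<in>{q\<in>\<rat>. 0 < q}. q < fst p \<and> u q (snd p) < t else 0 < t}"
    by simp
  also have "\<dots> \<in> sets (borel \<Otimes>\<^sub>M borel)"
  proof -
    have cnt: "countable {q::real\<in>\<rat>. 0 < q}"
      by (rule countable_subset[OF _ countable_rat]) auto
    have *: "{p \<in> space (borel \<Otimes>\<^sub>M borel). q < fst p \<and> u q (snd p) < t} \<in> sets (borel \<Otimes>\<^sub>M borel)"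
      if "q \<in> {q\<in>\<rat>. 0 < q}" for q
    proof -
      have [measurable]: "u q \<in> borel_measurable borel"
        using u that by simp
      show ?thesis by measurable
    qed
    have [measurable]: "Measurable.pred (borel \<Otimes>\<^sub>M borel)
        (\<lambda>p. \<exists>q\<in>{q\<in>\<rat>. 0 < q}. q < fst p \<and> u q (snd p) < t)"
      unfolding pred_def using sets.sets_Collect_countable_Ex'[OF * cnt] by simp
    show ?thesis by measurable
  qed
  finally show "{p \<in> space (borel \<Otimes>\<^sub>M borel). clipped g (fst p) (snd p) < t} \<in> sets (borel \<Otimes>\<^sub>M borel)" .
qed

text \<open>A gain determines the distance by strict monotonicity, so the level set lies on a circle
  together with the origin, where the clipped value is 0.\<close>

lemma emeasure_clipped_level:
  assumes "z > 0"
  shows "emeasure lborel {y::point. clipped g (norm y) z = t} = 0"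
proof -
  have "\<exists>r. {y::point. clipped g (norm y) z = t} \<subseteq> insert 0 (sphere 0 r)"
  proof (cases "\<exists>r>0. g r z = t")
    case True
    then obtain r where r: "r > 0" "g r z = t" by blast
    have "norm y = r" if "y \<noteq> 0" "clipped g (norm y) z = t" for y :: point
      using r that assms gain_strict_antimono[of z r "norm y"] gain_strict_antimono[of z "norm y" r]
      by (cases "norm y" r rule: linorder_cases) (auto simp: clipped_def)
    then have "y \<in> insert 0 (sphere 0 r)" if "clipped g (norm y) z = t" for y :: point
      using that by (cases "y = 0") auto
    then show ?thesis
      by blast
  next
    case False
    then show ?thesis
      using assms by (auto simp: clipped_def split: if_splits)
  qed
  then obtain r where r: "{y::point. clipped g (norm y) z = t} \<subseteq> insert 0 (sphere 0 r)"
    by blast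
  have "negligible (insert 0 (sphere (0::point) r))"
    by (simp add: negligible_insert negligible_sphere)
  then have "insert 0 (sphere (0::point) r) \<in> null_sets lebesgue"
    by (simp add: negligible_iff_null_sets)
  moreover have "insert 0 (sphere (0::point) r) \<in> sets lborel"
    by (auto intro: borel_closed)
  ultimately have "insert 0 (sphere (0::point) r) \<in> null_sets lborel"
    using null_sets_completion_iff by blast
  then have "emeasure lborel (insert 0 (sphere (0::point) r)) = 0"
    by auto
  then show ?thesis
    using emeasure_mono[OF r, of lborel] \<open>insert 0 (sphere (0::point) r) \<in> sets lborel\<close> by simp
qed

end

text \<open>Beating the maximizer means beating every eavesdropper.
  \<open>strongest_eavesdropper\<close> is a choice term, so it has the maximality property only
  once a maximizer is known to exist.\<close>

lemma iS_graph_edge_iff: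
  assumes "P > 0" "n > 0" and "x \<in> V" "y \<in> V" "x \<noteq> y"
    and strongest: "has_strongest_eavesdropper g \<zeta> E x"
    and nonneg: "0 \<le> gain g \<zeta> x y" "\<And>e. e \<in> E \<Longrightarrow> 0 \<le> gain g \<zeta> x e"
  shows "(x, y) \<in> iS_graph 0 P n n g \<zeta> V E \<longleftrightarrow> (\<forall>e\<in>E. gain g \<zeta> x e < gain g \<zeta> x y)"
proof -
  let ?e = "strongest_eavesdropper g \<zeta> E x"
  have "is_arg_max (gain g \<zeta> x) (\<lambda>e. e \<in> E) ?e"
    using strongest unfolding has_strongest_eavesdropper_def strongest_eavesdropper_def
      arg_max_on_def arg_max_def by (rule someI_ex)
  then have e: "?e \<in> E" "\<And>e. e \<in> E \<Longrightarrow> gain g \<zeta> x e \<le> gain g \<zeta> x ?e"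
    by (auto simp: is_arg_max_linorder)
  then show ?thesis
    using assms by (subst iS_graph_zero_threshold_iff) (auto intro: le_less_trans)
qed

text \<open>A degree is known only up to a null set, on which its preimages may fail to be events of
  \<open>M\<close>; in the completion such a modification stays measurable and the integral is
  unchanged.\<close>

lemma completion_suminf_indicator:
  fixes N :: "'w \<Rightarrow> ennreal"
  assumes A: "\<And>i::nat. A i \<in> sets M" and N: "AE \<omega> in M. N \<omega> = (\<Sum>i. indicator (A i) \<omega>)"
  shows "N \<in> borel_measurable (completion M)"
    and "(\<integral>\<^sup>+\<omega>. N \<omega> \<partial>completion M) = (\<Sum>i. emeasure M (A i))"
proof -
  have S: "(\<lambda>\<omega>. \<Sum>i. indicator (A i) \<omega> :: ennreal) \<in> borel_measurable M"
    using A by measurable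
  have N': "AE \<omega> in completion M. N \<omega> = (\<Sum>i. indicator (A i) \<omega>)"
    using N by (rule AE_completion)
  show "N \<in> borel_measurable (completion M)"
  proof (rule measurableI)
    fix B :: "ennreal set" assume B: "B \<in> sets borel"
    have "(\<lambda>\<omega>. \<Sum>i. indicator (A i) \<omega>) -` B \<inter> space M \<in> sets (completion M)"
      using measurable_sets[OF S B] by simp
    then show "N -` B \<inter> space (completion M) \<in> sets (completion M)"
      by (rule completion.in_sets_AE[rotated]) (use N' in \<open>auto elim!: eventually_mono\<close>)
  qed simp
  have "(\<integral>\<^sup>+\<omega>. N \<omega> \<partial>completion M) = (\<integral>\<^sup>+\<omega>. (\<Sum>i. indicator (A i) \<omega>) \<partial>completion M)"
    using N' by (rule nn_integral_cong_AE)
  also have "\<dots> = (\<integral>\<^sup>+\<omega>. (\<Sum>i. indicator (A i) \<omega>) \<partial>M)"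
    by (rule nn_integral_completion)
  also have "\<dots> = (\<Sum>i. emeasure M (A i))"
    using A by (subst nn_integral_suminf) auto
  finally show "(\<integral>\<^sup>+\<omega>. N \<omega> \<partial>completion M) = (\<Sum>i. emeasure M (A i))" .
qed

section \<open>The exponent of the edge probabilities\<close>

locale iS_model = marked_ppp_pair M lam_l Pl lam_e Pe X Y Z f
  for M :: "'w measure" and lam_l Pl lam_e Pe X Y Z f +
  fixes g :: "real \<Rightarrow> real \<Rightarrow> real"
  assumes g: "power_gain_function g"
    and strongest: "AE \<omega> in M. \<forall>x\<in>insert 0 (Pl \<omega>). has_strongest_eavesdropper g (Z \<omega>) (Pe \<omega>) x"
begin

abbreviation mark where "mark \<equiv> link_mark X Y Z"
abbreviation h where "h \<equiv> clipped g"

lemma measurable_h [measurable (raw)]: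
  assumes "a \<in> borel_measurable N" "b \<in> borel_measurable N"
  shows "(\<lambda>x. h (a x) (b x)) \<in> borel_measurable N"
  using measurable_compose[OF measurable_Pair[OF assms] measurable_clipped[OF g]] by simp

lemma measurable_links [measurable]:
  "mark {Origin, Legit i} \<in> borel_measurable M"
  "mark {Origin, Eaves j} \<in> borel_measurable M"
  "mark {Legit i, Eaves j} \<in> borel_measurable M"
  by (simp_all add: measurable_mark links_Legit links_Eaves links_Legit_Eaves)

text \<open>The expected number of eavesdroppers whose gain at the origin is at least
  \<open>t\<close>. It is \<open>\<top>\<close> for \<open>t \<le> 0\<close>, since clipped gains
  are nonnegative.\<close>

definition L :: "real \<Rightarrow> ennreal" where
  "L t = ennreal lam_e * (\<integral>\<^sup>+y. emeasure D {v. t \<le> h (norm (y::point)) v} \<partial>lborel)"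

text \<open>Recentres the eavesdropper integral at a transmitter \<open>x\<close>, after which the
  integrals for the two degrees are literally the same.\<close>

lemma L_shift: "ennreal lam_e * (\<integral>\<^sup>+y. emeasure D {v. t \<le> h (dist (x::point) y) v} \<partial>lborel) = L t"
proof -
  have [measurable]: "(\<lambda>y. emeasure D {v. t \<le> h (dist (x::point) y) v}) \<in> borel_measurable borel"
  proof -
    have "{p \<in> space (borel \<Otimes>\<^sub>M D). t \<le> h (dist x (fst p)) (snd p)} \<in> sets (borel \<Otimes>\<^sub>M D)"
      by measurable
    from D.measurable_emeasure_Pair[OF this] show ?thesis
      by (simp add: vimage_def space_pair_measure)
  qed
  have "(\<integral>\<^sup>+y. emeasure D {v. t \<le> h (dist (x::point) y) v} \<partial>lborel)
      = (\<integral>\<^sup>+y. emeasure D {v. t \<le> h (dist x y) v} \<partial>distr lborel borel ((+) x))"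
    by (simp add: lborel_distr_plus)
  also have "\<dots> = (\<integral>\<^sup>+y. emeasure D {v. t \<le> h (norm (y::point)) v} \<partial>lborel)"
    by (subst nn_integral_distr) (auto simp: dist_norm)
  finally show ?thesis
    by (simp add: L_def)
qed

text \<open>For almost every mark the positions with gain exactly \<open>t\<close> form a null set,
  so by Tonelli ties do not contribute. This is what makes the strongest gain atomless.\<close>

lemma L_eq_strict: "L t = ennreal lam_e * (\<integral>\<^sup>+y. emeasure D {v. t < h (norm (y::point)) v} \<partial>lborel)"
proof -
  interpret P: pair_sigma_finite "lborel :: point measure" D
    by unfold_locales
  have meas: "(\<lambda>y. emeasure D {v. Q (h (norm (y::point)) v)}) \<in> borel_measurable lborel"
    if [measurable]: "Measurable.pred borel Q" for Q
  proof -
    have "{p \<in> space (lborel \<Otimes>\<^sub>M D). Q (h (norm (fst p :: point)) (snd p))} \<in> sets (lborel \<Otimes>\<^sub>M D)"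
      by measurable
    from D.measurable_emeasure_Pair[OF this] show ?thesis
      by (simp add: vimage_def space_pair_measure)
  qed
  have "(\<integral>\<^sup>+y. emeasure D {v. h (norm (y::point)) v = t} \<partial>lborel)
      = (\<integral>\<^sup>+y. \<integral>\<^sup>+v. indicator {p. h (norm (fst p :: point)) (snd p) = t} (y, v) \<partial>D \<partial>lborel)"
  proof (rule nn_integral_cong)
    fix y :: point
    have "(\<integral>\<^sup>+v. indicator {p. h (norm (fst p)) (snd p) = t} (y, v) \<partial>D) = (\<integral>\<^sup>+v. indicator {v. h (norm y) v = t} v \<partial>D)"
      by (intro nn_integral_cong) (auto split: split_indicator)
    then show "emeasure D {v. h (norm y) v = t} = (\<integral>\<^sup>+v. indicator {p. h (norm (fst p)) (snd p) = t} (y, v) \<partial>D)"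
      by simp
  qed
  also have "\<dots> = (\<integral>\<^sup>+v. \<integral>\<^sup>+y. indicator {p. h (norm (fst p :: point)) (snd p) = t} (y, v) \<partial>lborel \<partial>D)"
    by (rule P.Fubini'[symmetric]) measurable
  also have "\<dots> = (\<integral>\<^sup>+v. 0 \<partial>D)"
  proof (rule nn_integral_cong_AE, use AE_D_pos in eventually_elim)
    case (elim v)
    have "(\<integral>\<^sup>+y. indicator {p. h (norm (fst p :: point)) (snd p) = t} (y, v) \<partial>lborel)
        = (\<integral>\<^sup>+y. indicator {y::point. h (norm y) v = t} y \<partial>lborel)"
      by (intro nn_integral_cong) (auto split: split_indicator)
    then show ?case
      using emeasure_clipped_level[OF g elim, of t] by simp
  qed
  finally have zero: "(\<integral>\<^sup>+y. emeasure D {v. h (norm (y::point)) v = t} \<partial>lborel) = 0"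
    by simp
  have "emeasure D {v. t \<le> h (norm y) v} = emeasure D {v. t < h (norm y) v} + emeasure D {v. h (norm y) v = t}"
    for y :: point
    by (subst plus_emeasure) (auto intro!: arg_cong[where f = "emeasure D"])
  then have "(\<integral>\<^sup>+y. emeasure D {v. t \<le> h (norm (y::point)) v} \<partial>lborel)
      = (\<integral>\<^sup>+y. emeasure D {v. t < h (norm (y::point)) v} \<partial>lborel)"
    using meas[of "\<lambda>x. t < x"] meas[of "\<lambda>x. x = t"] by (simp add: nn_integral_add zero)
  then show ?thesis
    by (simp add: L_def)
qed

lemma antimono_L: "antimono L"
  unfolding L_def
proof (intro antimonoI mult_left_mono nn_integral_mono emeasure_mono)
  show "{v. t \<le> h (norm y) v} \<in> sets D" for t and y :: point
    by measurable
qed auto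

lemma measurable_L [measurable]: "L \<in> borel_measurable borel"
proof -
  have "{p \<in> space ((borel \<Otimes>\<^sub>M borel) \<Otimes>\<^sub>M D). fst (fst p) \<le> h (norm (snd (fst p) :: point)) (snd p)}
      \<in> sets ((borel \<Otimes>\<^sub>M borel) \<Otimes>\<^sub>M D)"
    by measurable
  from D.measurable_emeasure_Pair[OF this]
  have "(\<lambda>q. emeasure D {v. fst q \<le> h (norm (snd q :: point)) v}) \<in> borel_measurable (borel \<Otimes>\<^sub>M borel)"
    by (simp add: vimage_def space_pair_measure)
  then have "(\<lambda>q. emeasure D {v. fst q \<le> h (norm (snd q :: point)) v}) \<in> borel_measurable (borel \<Otimes>\<^sub>M lborel)"
    by simp
  from lborel.borel_measurable_nn_integral_fst[OF this] show ?thesis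
    unfolding L_def by simp
qed

end

section \<open>The strongest eavesdropper gain at the origin\<close>

context iS_model
begin

text \<open>Countably many null events are collected so that all relevant distances and marks are
  positive, where clipping changes nothing.\<close>

lemma AE_regular:
  "AE \<omega> in M. range (\<lambda>i. X i \<omega>) = Pl \<omega> \<and> range (\<lambda>j. Y j \<omega>) = Pe \<omega> \<and>
    0 \<notin> Pl \<omega> \<and> 0 \<notin> Pe \<omega> \<and> Pl \<omega> \<inter> Pe \<omega> = {} \<and>
    (\<forall>i. 0 < mark {Origin, Legit i} \<omega>) \<and> (\<forall>j. 0 < mark {Origin, Eaves j} \<omega>) \<and>
    (\<forall>i j. 0 < mark {Legit i, Eaves j} \<omega>)"
proof -
  have "AE \<omega> in M. \<forall>i. 0 < mark {Origin, Legit i} \<omega>"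
    by (simp add: AE_all_countable marks_pos links_Legit)
  moreover have "AE \<omega> in M. \<forall>j. 0 < mark {Origin, Eaves j} \<omega>"
    by (simp add: AE_all_countable marks_pos links_Eaves)
  moreover have "AE \<omega> in M. \<forall>i j. 0 < mark {Legit i, Eaves j} \<omega>"
    by (simp add: AE_all_countable marks_pos links_Legit_Eaves)
  moreover have "AE \<omega> in M. range (\<lambda>i. X i \<omega>) = Pl \<omega>" "AE \<omega> in M. range (\<lambda>j. Y j \<omega>) = Pe \<omega>"
    using X Y by (simp_all add: enumerates_def)
  ultimately show ?thesis
    using L.AE_not_in_points[of 0] E.AE_not_in_points[of 0] AE_points_disjoint[OF X]
    by eventually_elim simp
qed

lemma gain_eq_clipped:
  assumes "x \<noteq> y" "0 < \<zeta> {x, y}"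
  shows "gain g \<zeta> x y = h (dist x y) (\<zeta> {x, y})"
  using assms by (simp add: gain_def clipped_def)

text \<open>A supremum over the enumeration, instead of the gain at a chosen maximizer, is visibly
  measurable. An infinite supremum would be sent to 0 by \<open>enn2real\<close>; it is excluded
  almost surely because a maximizer exists.\<close>

definition max_gain :: "'w \<Rightarrow> real" where
  "max_gain \<omega> = enn2real (SUP j. ennreal (h (norm (Y j \<omega>)) (mark {Origin, Eaves j} \<omega>)))"

lemma measurable_max_gain [measurable]: "max_gain \<in> borel_measurable M"
  unfolding max_gain_def by measurable

text \<open>The supremum is attained, which is essential for the strict event: all gains lying below
  \<open>t\<close> would give only \<open>max_gain \<omega> \<le> t\<close> for a mere
  supremum.\<close>

lemma AE_max_gain:
  "AE \<omega> in M. \<exists>j. max_gain \<omega> = h (norm (Y j \<omega>)) (mark {Origin, Eaves j} \<omega>) \<and>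
    (\<forall>k. h (norm (Y k \<omega>)) (mark {Origin, Eaves k} \<omega>) \<le> max_gain \<omega>)"
  using AE_regular strongest
proof eventually_elim
  case (elim \<omega>)
  let ?h = "\<lambda>j. h (norm (Y j \<omega>)) (mark {Origin, Eaves j} \<omega>)"
  have gain: "gain g (Z \<omega>) 0 (Y j \<omega>) = ?h j" for j
  proof -
    have "Y j \<omega> \<noteq> 0" "0 < Z \<omega> {0, Y j \<omega>}"
      using elim(1) by (auto simp: link_mark_def)
    then show ?thesis
      by (subst gain_eq_clipped) (auto simp: link_mark_def)
  qed
  obtain e where e: "is_arg_max (gain g (Z \<omega>) 0) (\<lambda>e. e \<in> Pe \<omega>) e"
    using elim(2) by (auto simp: has_strongest_eavesdropper_def)
  then have "e \<in> range (\<lambda>j. Y j \<omega>)"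
    using elim(1) by (simp add: is_arg_max_def)
  then obtain j where j: "e = Y j \<omega>"
    by blast
  have le: "?h k \<le> ?h j" for k
    using e elim(1) by (auto simp: is_arg_max_linorder j gain[symmetric])
  then have "(SUP k. ennreal (?h k)) = ennreal (?h j)"
    by (intro antisym SUP_least ennreal_leI SUP_upper) auto
  then have "max_gain \<omega> = ?h j"
    by (simp add: max_gain_def clipped_nonneg[OF g])
  then show ?case
    using le by auto
qed

lemma emeasure_max_gain_less: "emeasure M {\<omega>\<in>space M. max_gain \<omega> < t} = nexp (L t)"
proof -
  have "emeasure M {\<omega>\<in>space M. max_gain \<omega> < t}
      = emeasure M {\<omega>\<in>space M. \<forall>j. h (norm (Y j \<omega>)) (mark {Origin, Eaves j} \<omega>) < t}"
  proof (rule emeasure_eq_AE)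
    show "AE \<omega> in M. \<omega> \<in> {\<omega>\<in>space M. max_gain \<omega> < t} \<longleftrightarrow>
        \<omega> \<in> {\<omega>\<in>space M. \<forall>j. h (norm (Y j \<omega>)) (mark {Origin, Eaves j} \<omega>) < t}"
      using AE_max_gain by eventually_elim (auto intro: le_less_trans)
  qed measurable
  also have "\<dots> = nexp (L t)"
    unfolding L_def not_less[symmetric]
    by (rule emeasure_void[where l = "\<lambda>j. {Origin, Eaves j}" and s = "{Origin, Legit 0}"])
      (auto simp: inj_def doubleton_eq_iff links_Eaves links_Legit)
  finally show ?thesis .
qed

lemma emeasure_max_gain_le: "emeasure M {\<omega>\<in>space M. max_gain \<omega> \<le> t} = nexp (L t)"
proof -
  have "emeasure M {\<omega>\<in>space M. max_gain \<omega> \<le> t}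
      = emeasure M {\<omega>\<in>space M. \<forall>j. h (norm (Y j \<omega>)) (mark {Origin, Eaves j} \<omega>) \<le> t}"
  proof (rule emeasure_eq_AE)
    show "AE \<omega> in M. \<omega> \<in> {\<omega>\<in>space M. max_gain \<omega> \<le> t} \<longleftrightarrow>
        \<omega> \<in> {\<omega>\<in>space M. \<forall>j. h (norm (Y j \<omega>)) (mark {Origin, Eaves j} \<omega>) \<le> t}"
      using AE_max_gain by eventually_elim (auto intro: order_trans)
  qed measurable
  \<comment> \<open>The complement of \<open>\<le> t\<close> is strict exceedance, and
    \<open>L_eq_strict\<close> leads back to the same \<open>L t\<close> as in the strict
    case.\<close>
  also have "\<dots> = nexp (L t)"
    unfolding L_eq_strict not_le[symmetric]
    by (rule emeasure_void[where l = "\<lambda>j. {Origin, Eaves j}" and s = "{Origin, Legit 0}"])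
      (auto simp: inj_def doubleton_eq_iff links_Eaves links_Legit)
  finally show ?thesis .
qed

lemma nn_integral_L_max_gain: "(\<integral>\<^sup>+\<omega>. L (max_gain \<omega>) \<partial>M) = 1"
  by (rule L.nn_integral_hazard_eq_1[OF measurable_max_gain measurable_L antimono_L
        emeasure_max_gain_less emeasure_max_gain_le])

text \<open>\<open>nexp (L t)\<close> is the probability of \<open>max_gain \<omega> < t\<close> for
  one and the same random variable at every \<open>(x, w)\<close>, so Tonelli applies. The pairs
  \<open>(x, w)\<close> that beat a fixed outcome have measure
  \<open>L (max_gain \<omega>) / lam_e\<close>, by the strict form of \<open>L\<close>.\<close>

lemma nn_integral_nexp_L:
  "ennreal lam_l * (\<integral>\<^sup>+x. \<integral>\<^sup>+w. nexp (L (h (norm (x::point)) w)) \<partial>D \<partial>lborel) = ennreal (lam_l / lam_e)"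
proof -
  let ?N = "(lborel :: point measure) \<Otimes>\<^sub>M D"
  interpret N: pair_sigma_finite "lborel :: point measure" D
    by unfold_locales
  interpret NM: pair_sigma_finite ?N M
    by unfold_locales
  let ?g = "\<lambda>p. h (norm (fst p :: point)) (snd p)"
  have "(\<integral>\<^sup>+x. \<integral>\<^sup>+w. nexp (L (h (norm (x::point)) w)) \<partial>D \<partial>lborel) = (\<integral>\<^sup>+p. nexp (L (?g p)) \<partial>?N)"
  proof -
    have "(\<lambda>p. nexp (L (?g p))) \<in> borel_measurable ?N"
      by measurable
    from D.nn_integral_fst[OF this] show ?thesis
      by simp
  qed
  also have "\<dots> = (\<integral>\<^sup>+p. \<integral>\<^sup>+\<omega>. indicator {q. max_gain (snd q) < ?g (fst q)} (p, \<omega>) \<partial>M \<partial>?N)"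
  proof (rule nn_integral_cong)
    fix p :: "point \<times> real"
    have "(\<integral>\<^sup>+\<omega>. indicator {q. max_gain (snd q) < ?g (fst q)} (p, \<omega>) \<partial>M)
        = (\<integral>\<^sup>+\<omega>. indicator {\<omega>\<in>space M. max_gain \<omega> < ?g p} \<omega> \<partial>M)"
      by (intro nn_integral_cong) (auto split: split_indicator)
    then show "nexp (L (?g p)) = (\<integral>\<^sup>+\<omega>. indicator {q. max_gain (snd q) < ?g (fst q)} (p, \<omega>) \<partial>M)"
      by (simp add: emeasure_max_gain_less)
  qed
  also have "\<dots> = (\<integral>\<^sup>+\<omega>. \<integral>\<^sup>+p. indicator {q. max_gain (snd q) < ?g (fst q)} (p, \<omega>) \<partial>?N \<partial>M)"
    by (rule NM.Fubini'[symmetric]) measurable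
  also have "\<dots> = (\<integral>\<^sup>+\<omega>. (\<integral>\<^sup>+x. emeasure D {w. max_gain \<omega> < h (norm (x::point)) w} \<partial>lborel) \<partial>M)"
  proof (rule nn_integral_cong)
    fix \<omega>
    have "{p \<in> space ?N. max_gain \<omega> < ?g p} \<in> sets ?N"
      by measurable
    then have "(\<lambda>p. indicator {p. max_gain \<omega> < ?g p} p :: ennreal) \<in> borel_measurable ?N"
      by (intro borel_measurable_indicator) (simp add: space_pair_measure)
    then have meas: "(\<lambda>p. indicator {q. max_gain (snd q) < ?g (fst q)} (p, \<omega>) :: ennreal) \<in> borel_measurable ?N"
      by (simp add: indicator_def)
    have "(\<integral>\<^sup>+p. indicator {q. max_gain (snd q) < ?g (fst q)} (p, \<omega>) \<partial>?N)
        = (\<integral>\<^sup>+x. \<integral>\<^sup>+w. indicator {q. max_gain (snd q) < ?g (fst q)} ((x, w), \<omega>) \<partial>D \<partial>lborel)"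
      by (rule D.nn_integral_fst[symmetric, OF meas])
    also have "\<dots> = (\<integral>\<^sup>+x. \<integral>\<^sup>+w. indicator {w. max_gain \<omega> < h (norm (x::point)) w} w \<partial>D \<partial>lborel)"
      by (intro nn_integral_cong) (auto split: split_indicator)
    also have "\<dots> = (\<integral>\<^sup>+x. emeasure D {w. max_gain \<omega> < h (norm (x::point)) w} \<partial>lborel)"
      by simp
    finally show "(\<integral>\<^sup>+p. indicator {q. max_gain (snd q) < ?g (fst q)} (p, \<omega>) \<partial>?N)
        = (\<integral>\<^sup>+x. emeasure D {w. max_gain \<omega> < h (norm (x::point)) w} \<partial>lborel)" .
  qed
  finally have I: "(\<integral>\<^sup>+x. \<integral>\<^sup>+w. nexp (L (h (norm (x::point)) w)) \<partial>D \<partial>lborel)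
      = (\<integral>\<^sup>+\<omega>. (\<integral>\<^sup>+x. emeasure D {w. max_gain \<omega> < h (norm (x::point)) w} \<partial>lborel) \<partial>M)" (is "?I = ?J") .
  have L': "(\<integral>\<^sup>+x. emeasure D {w. t < h (norm (x::point)) w} \<partial>lborel) = ennreal (1 / lam_e) * L t" for t
    unfolding L_eq_strict mult.assoc[symmetric]
    using E.lam_pos by (simp add: ennreal_mult''[symmetric])
  have "?J = ennreal (1 / lam_e)"
    unfolding L' by (simp add: nn_integral_cmult nn_integral_L_max_gain)
  then show ?thesis
    unfolding I using E.lam_pos L.lam_pos by (simp add: ennreal_mult'[symmetric])
qed

section \<open>Edges at the origin and the two mean degrees\<close>

context
  fixes P n :: real
  assumes P: "P > 0" and n: "n > 0"
begin

abbreviation G where "G \<omega> \<equiv> iS_graph 0 P n n g (Z \<omega>) (insert 0 (Pl \<omega>)) (Pe \<omega>)"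

text \<open>The enumeration is almost surely a bijection onto \<open>Pl \<omega>\<close>, so
  counting \<open>A \<omega>\<close> is summing over labels. The origin is not labelled by
  \<open>X\<close>; it is left out because the graph has no loops.\<close>

lemma suminf_indicator_points:
  assumes "AE \<omega> in M. \<forall>i. X i \<omega> \<in> A \<omega> \<longleftrightarrow> \<omega> \<in> B i" and "\<And>\<omega>. A \<omega> \<subseteq> insert 0 (Pl \<omega>)" "\<And>\<omega>. 0 \<notin> A \<omega>"
  shows "AE \<omega> in M. emeasure (count_space UNIV) (A \<omega>) = (\<Sum>i. indicator (B i) \<omega>)"
  using assms(1) enumerates_suminf[OF X]
proof eventually_elim
  case (elim \<omega>)
  have "A \<omega> = Pl \<omega> \<inter> A \<omega>"
    using assms(2)[of \<omega>] assms(3)[of \<omega>] by auto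
  then have "emeasure (count_space UNIV) (A \<omega>) = (\<integral>\<^sup>+y. indicator (A \<omega>) y \<partial>count_space (Pl \<omega>))"
    by (simp add: nn_integral_indicator_count_space)
  also have "\<dots> = (\<Sum>i. indicator (A \<omega>) (X i \<omega>))"
    using elim(2) by simp
  also have "\<dots> = (\<Sum>i. indicator (B i) \<omega>)"
    using elim(1) by (simp add: indicator_def)
  finally show ?case .
qed

definition out_event :: "nat \<Rightarrow> 'w set" where
  "out_event i = {\<omega>\<in>space M. \<forall>j. h (norm (Y j \<omega>)) (mark {Origin, Eaves j} \<omega>)
      < h (norm (X i \<omega>)) (mark {Origin, Legit i} \<omega>)}"

text \<open>The link between the origin and \<open>X i\<close> carries one mark for both directions,
  so the right-hand side is that of \<open>out_event\<close>; the eavesdroppers are now seen from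
  the transmitter \<open>X i\<close>.\<close>

definition in_event :: "nat \<Rightarrow> 'w set" where
  "in_event i = {\<omega>\<in>space M. \<forall>j. h (dist (X i \<omega>) (Y j \<omega>)) (mark {Legit i, Eaves j} \<omega>)
      < h (norm (X i \<omega>)) (mark {Origin, Legit i} \<omega>)}"

lemma sets_events: "out_event i \<in> sets M" "in_event i \<in> sets M"
  unfolding out_event_def in_event_def by measurable

text \<open>The passage from points to labels: on regular outcomes the true gains are clipped gains
  of labelled marks, and the points of \<open>Pe\<close> are the values of \<open>Y\<close>.\<close>

lemma AE_edges:
  "AE \<omega> in M. \<forall>i. ((0, X i \<omega>) \<in> G \<omega> \<longleftrightarrow> \<omega> \<in> out_event i) \<and> ((X i \<omega>, 0) \<in> G \<omega> \<longleftrightarrow> \<omega> \<in> in_event i)"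
  using AE_regular strongest AE_space
proof eventually_elim
  case (elim \<omega>)
  have Y_gain: "gain g (Z \<omega>) 0 (Y j \<omega>) = h (norm (Y j \<omega>)) (mark {Origin, Eaves j} \<omega>)" for j
  proof -
    have "Y j \<omega> \<noteq> 0" "0 < Z \<omega> {0, Y j \<omega>}"
      using elim(1) by (auto simp: link_mark_def)
    then show ?thesis
      by (subst gain_eq_clipped) (auto simp: link_mark_def)
  qed
  have X0: "X i \<omega> \<noteq> 0" "0 < Z \<omega> {0, X i \<omega>}" "X i \<omega> \<in> Pl \<omega>" for i
    using elim(1) by (auto simp: link_mark_def)
  have X_gain: "gain g (Z \<omega>) 0 (X i \<omega>) = h (norm (X i \<omega>)) (mark {Origin, Legit i} \<omega>)"
    "gain g (Z \<omega>) (X i \<omega>) 0 = h (norm (X i \<omega>)) (mark {Origin, Legit i} \<omega>)" for i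
    using X0[of i] by (auto simp: gain_eq_clipped link_mark_def insert_commute)
  have XY_gain: "gain g (Z \<omega>) (X i \<omega>) (Y j \<omega>) = h (dist (X i \<omega>) (Y j \<omega>)) (mark {Legit i, Eaves j} \<omega>)" for i j
  proof -
    have "X i \<omega> \<noteq> Y j \<omega>" "0 < Z \<omega> {X i \<omega>, Y j \<omega>}"
      using elim(1) by (auto simp: link_mark_def)
    then show ?thesis
      by (subst gain_eq_clipped) (auto simp: link_mark_def)
  qed
  have Pe: "Pe \<omega> = range (\<lambda>j. Y j \<omega>)"
    using elim(1) by simp
  show ?case
  proof (intro allI conjI)
    fix i
    show "(0, X i \<omega>) \<in> G \<omega> \<longleftrightarrow> \<omega> \<in> out_event i"
      using elim X0[of i] P n
      by (subst iS_graph_edge_iff)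
        (auto simp: out_event_def Pe Y_gain X_gain clipped_nonneg[OF g])
    show "(X i \<omega>, 0) \<in> G \<omega> \<longleftrightarrow> \<omega> \<in> in_event i"
      using elim X0[of i] P n
      by (subst iS_graph_edge_iff)
        (auto simp: in_event_def Pe XY_gain X_gain clipped_nonneg[OF g])
  qed
qed

lemma sum_out_event: "(\<Sum>i. emeasure M (out_event i)) = ennreal (lam_l / lam_e)"
proof -
  have "(\<Sum>i. emeasure M (out_event i)) = ennreal lam_l * (\<integral>\<^sup>+(x::point). \<integral>\<^sup>+w.
      nexp (ennreal lam_e * (\<integral>\<^sup>+(y::point). emeasure D {v. \<not> h (norm y) v < h (norm x) w} \<partial>lborel)) \<partial>D \<partial>lborel)"
    unfolding out_event_def
  proof (rule sum_emeasure_all_links[where S = "\<lambda>(x::point) (y::point) v w. h (norm y) v < h (norm x) w"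
        and l = "\<lambda>i j. {Origin, Eaves j}" and s = "\<lambda>i. {Origin, Legit i}"])
    show "Measurable.pred (borel \<Otimes>\<^sub>M borel \<Otimes>\<^sub>M borel \<Otimes>\<^sub>M borel)
        (\<lambda>(x::point, y::point, v, w). h (norm y) v < h (norm x) w)"
      by measurable
  qed (auto simp: inj_def doubleton_eq_iff links_Eaves links_Legit links_Legit_Eaves)
  also have "\<dots> = ennreal (lam_l / lam_e)"
    unfolding not_less L_def[symmetric] by (rule nn_integral_nexp_L)
  finally show ?thesis .
qed

text \<open>The eavesdropper marks now change with \<open>i\<close>, but for each \<open>i\<close>
  they are again i.i.d., which suffices since edges from different nodes are never considered
  jointly.\<close>

lemma sum_in_event: "(\<Sum>i. emeasure M (in_event i)) = ennreal (lam_l / lam_e)"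
proof -
  have "(\<Sum>i. emeasure M (in_event i)) = ennreal lam_l * (\<integral>\<^sup>+(x::point). \<integral>\<^sup>+w.
      nexp (ennreal lam_e * (\<integral>\<^sup>+(y::point). emeasure D {v. \<not> h (dist x y) v < h (norm x) w} \<partial>lborel)) \<partial>D \<partial>lborel)"
    unfolding in_event_def
  proof (rule sum_emeasure_all_links[where S = "\<lambda>(x::point) (y::point) v w. h (dist x y) v < h (norm x) w"
        and l = "\<lambda>i j. {Legit i, Eaves j}" and s = "\<lambda>i. {Origin, Legit i}"])
    show "Measurable.pred (borel \<Otimes>\<^sub>M borel \<Otimes>\<^sub>M borel \<Otimes>\<^sub>M borel)
        (\<lambda>(x::point, y::point, v, w). h (dist x y) v < h (norm x) w)"
      by measurable
  qed (auto simp: inj_def doubleton_eq_iff links_Eaves links_Legit links_Legit_Eaves)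
  also have "\<dots> = ennreal (lam_l / lam_e)"
    unfolding not_less L_shift by (rule nn_integral_nexp_L)
  finally show ?thesis .
qed

lemma AE_out_degree: "AE \<omega> in M. out_degree (G \<omega>) 0 = (\<Sum>i. indicator (out_event i) \<omega>)"
  unfolding out_degree_def
proof (rule suminf_indicator_points)
  show "AE \<omega> in M. \<forall>i. X i \<omega> \<in> {y. (0, y) \<in> G \<omega>} \<longleftrightarrow> \<omega> \<in> out_event i"
    using AE_edges by eventually_elim simp
qed (auto simp: iS_graph_def)

lemma AE_in_degree: "AE \<omega> in M. in_degree (G \<omega>) 0 = (\<Sum>i. indicator (in_event i) \<omega>)"
  unfolding in_degree_def
proof (rule suminf_indicator_points)
  show "AE \<omega> in M. \<forall>i. X i \<omega> \<in> {y. (y, 0) \<in> G \<omega>} \<longleftrightarrow> \<omega> \<in> in_event i"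
    using AE_edges by eventually_elim simp
qed (auto simp: iS_graph_def)

lemmas average_degrees =
  completion_suminf_indicator[OF sets_events(2) AE_in_degree, unfolded sum_in_event]
  completion_suminf_indicator[OF sets_events(1) AE_out_degree, unfolded sum_out_event]

end

end

theorem corollary3p3:
  fixes M :: "'w measure"
    and Pl Pe :: "'w \<Rightarrow> point set"
    and Z :: "'w \<Rightarrow> point set \<Rightarrow> real"
    and f :: "real \<Rightarrow> real"
    and g :: "real \<Rightarrow> real \<Rightarrow> real"
    and lam_l lam_e P n :: real
    and G :: "'w \<Rightarrow> (point \<times> point) set"
    and N_in N_out :: "'w \<Rightarrow> ennreal"
  assumes "prob_space M"
    and "lam_l > 0" "lam_e > 0" "P > 0" "n > 0"
    and "poisson_point_process M lam_l Pl"
    and "poisson_point_process M lam_e Pe"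
    and "indep_processes M Pl Pe"
    and "\<And>z. f z \<ge> 0"
    and "iid_link_marks M Pl Pe Z f"
    and "power_gain_function g"
    and "AE \<omega> in M. \<forall>x\<in>insert 0 (Pl \<omega>). has_strongest_eavesdropper g (Z \<omega>) (Pe \<omega>) x"
  defines "G \<equiv> \<lambda>\<omega>. iS_graph 0 P n n g (Z \<omega>) (insert 0 (Pl \<omega>)) (Pe \<omega>)"
    and "N_in \<equiv> \<lambda>\<omega>. in_degree (G \<omega>) 0"
    and "N_out \<equiv> \<lambda>\<omega>. out_degree (G \<omega>) 0"
  shows "N_in \<in> borel_measurable (completion M) \<and>
         N_out \<in> borel_measurable (completion M) \<and>
         (\<integral>\<^sup>+\<omega>. N_in \<omega> \<partial>completion M) = ennreal (lam_l / lam_e) \<and>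
         (\<integral>\<^sup>+\<omega>. N_out \<omega> \<partial>completion M) = ennreal (lam_l / lam_e)"
proof -
  interpret prob_space M by fact
  \<comment> \<open>The enumerations are only witnesses: the degrees do not mention labels, so any
    such pair serves.\<close>
  obtain X Y where "enumerates M X Pl" "enumerates M Y Pe"
    and "indep_vars (\<lambda>_. borel) (link_mark X Y Z) links"
    and "\<forall>s\<in>links. distributed M lborel (link_mark X Y Z s) (\<lambda>z. ennreal (f z)) \<and>
          (AE \<omega> in M. link_mark X Y Z s \<omega> > 0)"
    and "indep_set
          (sets (vimage_algebra (space M) (position X Y) (Pi\<^sub>M UNIV (\<lambda>_. borel))))
          (sets (vimage_algebra (space M) (\<lambda>\<omega>. \<lambda>s\<in>links. link_mark X Y Z s \<omega>)
                   (Pi\<^sub>M links (\<lambda>_. borel))))"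
    using assms(10) unfolding iid_link_marks_def by blast
  then interpret iS_model M lam_l Pl lam_e Pe X Y Z f g
    using assms by unfold_locales simp_all
  show ?thesis
    using average_degrees[OF \<open>P > 0\<close> \<open>n > 0\<close>]
    unfolding N_in_def N_out_def G_def by simp
qed

end
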